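(* Let $\mathcal L$ be a finite distributive lattice with poset of join-irreducible elements $(P,<)$. The cone $\psi(C(I^h,I^m))$ is a maximal cone in the secondary fan of the order polytope $O(P,<)$.
   Context: $(\mathcal L,\vee,\wedge)$ is a finite distributive lattice with induced order $<$. $P$ is the set of join-irreducible elements of $\mathcal L$ (non-minimal $a$ such that $a=b\vee c$ implies $a=b$ or $a=c$), with the induced order $<$. The map $\iota:a\mapsto\{p\in P: p\le a\}$ is a lattice isomorphism from $\mathcal L$ to the lattice of order ideals (lower sets) of $(P,<)$ (Birkhoff). Put $v_a=\mathbf 1_{\iota(a)}\in\mathbb R^P$. The order polytope $O(P,<)\subset\mathbb R^P$ consists of $x$ with $0\le x_p\le 1$ for all $p$ and $x_p\le x_q$ whenever $p>q$; its vertex set is $V=\{v_a:a\in\mathcal L\}$. $\psi:\mathbb R^{\mathcal L}\to\mathbb R^V$ is the linear isomorphism with $\psi(w)_{v_a}=w_a$. $R=\mathbb C[\{X_a,a\in\mathcal L\}]$. For $w\in\mathbb R^{\mathcal L}$ define an $\mathbb R$-grading on $R$ by giving $X_a$ grading $w_a$; for nonzero $p\in R$, $\mathrm{in}_w p$ is the nonzero homogeneous component of $p$ of least grading, and $\mathrm{in}_w I$ is the linear span of $\{\mathrm{in}_w p: p\in I\}$. $C(I,J)=\{w\in\mathbb R^{\mathcal L}:\mathrm{in}_w I=J\}$. The Hibi ideal $I^h\subset R$ is generated by all $X_aX_b-X_{a\vee b}X_{a\wedge b}$; $I^m\subset R$ is generated by all $X_aX_b$ with $a,b$ incomparable. For an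 $n$-dimensional convex polytope $Q\subset \mathbb R^n$ with vertex set $V$ and $c\in\mathbb R^V$, let $T\subset\mathbb R^n\times\mathbb R$ be the convex hull of the union of the rays $\{v\}\times\{x\le c_v\}$, $v\in V$. The projections to $\mathbb R^n$ of the bounded facets of $T$ form a polyhedral subdivision $\Theta_Q(c)$ of $Q$; such subdivisions are called regular. For a regular subdivision $\Theta$ let $C(\Theta)=\{c\in\mathbb R^V:\Theta_Q(c)=\Theta\}$. The sets $C(\Theta)$ are relatively open polyhedral cones that together form a polyhedral fan with support $\mathbb R^V$, the secondary fan of $Q$; the maximal cones are the full-dimensional ones. *)

theory Defs
  imports "HOL-Analysis.Analysis" "HOL-Analysis.Finite_Function_Topology"
begin

section \<open>Regular subdivisions and the secondary fan of a polytope\<close>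

definition vertices :: "'v::euclidean_space set \<Rightarrow> 'v set" where
  "vertices Q = {v. v extreme_point_of Q}"

text \<open>For a finite set \<open>V\<close>, the space \<open>\<real>\<^sup>V\<close> is the space of finitely supported real functions
  vanishing outside \<open>V\<close>, with the real vector space structure of the library.\<close>

definition coord_space :: "'v set \<Rightarrow> ('v \<Rightarrow>\<^sub>0 real) set" where
  "coord_space V = {c. Poly_Mapping.keys c \<subseteq> V}"

definition hypograph_hull :: "'v::euclidean_space set \<Rightarrow> ('v \<Rightarrow>\<^sub>0 real) \<Rightarrow> ('v \<times> real) set" where
  "hypograph_hull Q c = convex hull (\<Union>v\<in>vertices Q. {v} \<times> {..Poly_Mapping.lookup c v})"

text \<open>The library notion \<open>facet_of\<close> refers to the affine dimension of the set itself, so \<open>Q\<close> need not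
  be full-dimensional in the ambient type. A subdivision is given by its set of maximal cells.\<close>

definition regular_subdivision :: "'v::euclidean_space set \<Rightarrow> ('v \<Rightarrow>\<^sub>0 real) \<Rightarrow> 'v set set" where
  "regular_subdivision Q c = {fst ` F | F. F facet_of hypograph_hull Q c \<and> bounded F}"

definition secondary_cone :: "'v::euclidean_space set \<Rightarrow> 'v set set \<Rightarrow> ('v \<Rightarrow>\<^sub>0 real) set" where
  "secondary_cone Q \<Theta> = {c \<in> coord_space (vertices Q). regular_subdivision Q c = \<Theta>}"

definition secondary_fan :: "'v::euclidean_space set \<Rightarrow> ('v \<Rightarrow>\<^sub>0 real) set set" where
  "secondary_fan Q =
    {secondary_cone Q (regular_subdivision Q c) | c. c \<in> coord_space (vertices Q)}"

text \<open>The maximal cones of the secondary fan are the full-dimensional ones, i.e. those which span a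
  space of the dimension of \<open>\<real>\<^sup>V\<close>.\<close>

definition maximal_secondary_cone :: "'v::euclidean_space set \<Rightarrow> ('v \<Rightarrow>\<^sub>0 real) set \<Rightarrow> bool" where
  "maximal_secondary_cone Q C \<longleftrightarrow> C \<in> secondary_fan Q \<and> dim C = card (vertices Q)"


section \<open>Initial ideals\<close>

text \<open>\<open>\<complex>[X\<^sub>a, a \<in> L]\<close>: finitely supported maps from exponent vectors to coefficients, with the
  convolution product.\<close>

type_synonym 'a poly_ring = "('a \<Rightarrow>\<^sub>0 nat) \<Rightarrow>\<^sub>0 complex"

definition indet :: "'a \<Rightarrow> 'a poly_ring" where
  "indet a = Poly_Mapping.single (Poly_Mapping.single a 1) 1"

definition ideal_gen :: "'a poly_ring set \<Rightarrow> 'a poly_ring set" where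
  "ideal_gen S = module.span (*) S"

definition complex_span :: "'a poly_ring set \<Rightarrow> 'a poly_ring set" where
  "complex_span S = module.span (\<lambda>z p. Poly_Mapping.single 0 z * p) S"

definition grading :: "real ^ 'a \<Rightarrow> ('a::finite \<Rightarrow>\<^sub>0 nat) \<Rightarrow> real" where
  "grading w m = (\<Sum>a\<in>UNIV. real (Poly_Mapping.lookup m a) * w $ a)"

definition homogeneous_component :: "real ^ 'a \<Rightarrow> real \<Rightarrow> 'a::finite poly_ring \<Rightarrow> 'a poly_ring" where
  "homogeneous_component w d p =
    (\<Sum>m\<in>{m \<in> Poly_Mapping.keys p. grading w m = d}. Poly_Mapping.single m (Poly_Mapping.lookup p m))"

text \<open>Only meaningful for \<open>p \<noteq> 0\<close>.\<close>

definition initial_form :: "real ^ 'a \<Rightarrow> 'a::finite poly_ring \<Rightarrow> 'a poly_ring" where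
  "initial_form w p = homogeneous_component w (Min (grading w ` Poly_Mapping.keys p)) p"

definition initial_ideal :: "real ^ 'a \<Rightarrow> 'a::finite poly_ring set \<Rightarrow> 'a poly_ring set" where
  "initial_ideal w I = complex_span {initial_form w p | p. p \<in> I \<and> p \<noteq> 0}"

definition initial_cone :: "'a::finite poly_ring set \<Rightarrow> 'a poly_ring set \<Rightarrow> (real ^ 'a) set" where
  "initial_cone I J = {w. initial_ideal w I = J}"


section \<open>Hibi ideals and order polytopes of finite distributive lattices\<close>

definition hibi_ideal :: "'a::{finite, distrib_lattice} poly_ring set" where
  "hibi_ideal = ideal_gen {indet a * indet b - indet (sup a b) * indet (inf a b) | a b. True}"

definition incomparable_ideal :: "'a::{finite, distrib_lattice} poly_ring set" where
  "incomparable_ideal = ideal_gen {indet a * indet b | a b. \<not> a \<le> b \<and> \<not> b \<le> a}"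

definition join_irreducible :: "'a::{finite, distrib_lattice} \<Rightarrow> bool" where
  "join_irreducible a \<longleftrightarrow> (\<exists>b. b < a) \<and> (\<forall>b c. a = sup b c \<longrightarrow> a = b \<or> a = c)"

text \<open>\<open>\<real>\<^sup>P\<close> is realized as the coordinate subspace of \<open>\<real>\<^sup>L\<close> on which all coordinates outside \<open>P\<close>
  vanish. (\<open>P\<close> is empty for the one-element lattice, so it cannot be made a type.)\<close>

definition order_polytope :: "(real ^ 'a::{finite, distrib_lattice}) set" where
  "order_polytope = {x.
     (\<forall>p. \<not> join_irreducible p \<longrightarrow> x $ p = 0) \<and>
     (\<forall>p. join_irreducible p \<longrightarrow> 0 \<le> x $ p \<and> x $ p \<le> 1) \<and>
     (\<forall>p q. join_irreducible p \<and> join_irreducible q \<and> p > q \<longrightarrow> x $ p \<le> x $ q)}"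

definition birkhoff :: "'a::{finite, distrib_lattice} \<Rightarrow> 'a set" where
  "birkhoff a = {p. join_irreducible p \<and> p \<le> a}"

definition ideal_vertex :: "'a::{finite, distrib_lattice} \<Rightarrow> (real, 'a) vec" where
  "ideal_vertex a = (\<chi> p. indicator (birkhoff a) p)"

text \<open>The linear map with \<open>psi w\<close> taking the value \<open>w $ a\<close> at \<open>ideal_vertex a\<close>;
  see \<open>lookup_psi\<close> below.\<close>

definition psi :: "(real, 'a::{finite, distrib_lattice}) vec \<Rightarrow> ((real, 'a) vec \<Rightarrow>\<^sub>0 real)" where
  "psi w = (\<Sum>a\<in>UNIV. Poly_Mapping.single (ideal_vertex a) (w $ a))"

lemma le_if_birkhoff_subset:
  fixes a b :: "'a::{finite, distrib_lattice}"
  assumes "birkhoff a \<subseteq> birkhoff b"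
  shows "a \<le> b"
proof -
  have "trans {(x, y :: 'a). x < y}"
    by (auto intro: transI)
  then have "wf {(x, y :: 'a). x < y}"
    by (intro finite_acyclic_wf) (auto simp: acyclic_def trancl_id)
  then show ?thesis
    using assms
  proof (induction a rule: wf_induct_rule)
    case (less a)
    show ?case
    proof (cases "join_irreducible a")
      case True
      then show ?thesis using less.prems by (auto simp: birkhoff_def)
    next
      case False
      then consider "\<forall>c. \<not> c < a" | c d where "a = sup c d" "a \<noteq> c" "a \<noteq> d"
        unfolding join_irreducible_def by blast
      then show ?thesis
      proof cases
        case 1
        then have "inf a b = a" by (metis inf_le1 le_neq_trans)
        then show ?thesis by (simp add: le_iff_inf)
      next
        case 2
        then have lt: "c < a" "d < a" by (simp_all add: less_le)
        then have "birkhoff c \<subseteq> birkhoff b" "birkhoff d \<subseteq> birkhoff b"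
          using less.prems by (auto simp: birkhoff_def)
        then show ?thesis using less.IH lt 2 by auto
      qed
    qed
  qed
qed

lemma inj_ideal_vertex: "inj (ideal_vertex :: 'a::{finite, distrib_lattice} \<Rightarrow> _)"
proof (rule injI)
  fix a b :: 'a
  assume "ideal_vertex a = ideal_vertex b"
  then have "indicator (birkhoff a) p = (indicator (birkhoff b) p :: real)" for p
    unfolding ideal_vertex_def by (metis vec_lambda_beta)
  then have "birkhoff a = birkhoff b"
    by (metis (no_types) indicator_eq_1_iff subsetI subset_antisym)
  then show "a = b"
    by (simp add: le_if_birkhoff_subset order.antisym)
qed

lemma lookup_psi: "Poly_Mapping.lookup (psi w) (ideal_vertex a) = w $ a"
  unfolding psi_def
  by (simp add: lookup_sum lookup_single when_def inj_eq[OF inj_ideal_vertex])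

end

theory Submission
  imports Defs
begin

text \<open>
  Both cones turn out to be the cone of strictly supermodular \<open>w\<close>, those with
  \<open>w\<^sub>a + w\<^sub>b < w\<^sub>a\<^sub>\<or>\<^sub>b + w\<^sub>a\<^sub>\<and>\<^sub>b\<close> for incomparable \<open>a, b\<close>. For such \<open>w\<close> and a maximal chain \<open>C\<close>, the
  affine function \<open>g\<close> that interpolates \<open>w\<close> at the vertices \<open>v\<^sub>c\<close>, \<open>c \<in> C\<close>, satisfies
  \<open>g(v\<^sub>a) > w\<^sub>a\<close> for all \<open>a \<notin> C\<close>. Geometrically, the graph of \<open>g\<close> cuts out a bounded facet of the hypograph
  lying over the simplex of \<open>C\<close>; these simplices cover the order polytope, so there are no other
  bounded facets. Algebraically, among all monomials with the same image in the
  Hibi ring the one supported on a chain has strictly the largest grading, so it never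
  occurs in an initial form. Conversely, a failure of strict supermodularity at \<open>a, b\<close> puts a chain
  monomial into the initial ideal and puts \<open>v\<^sub>a, v\<^sub>b\<close> into a common cell.
\<close>

section \<open>Chains in a finite distributive lattice\<close>

lemma finite_ex_least:
  "\<exists>z :: 'a::{finite, lattice}. \<forall>a. z \<le> a"
  by (meson Inf_fin.coboundedI UNIV_I finite)

lemma finite_ex_greatest:
  "\<exists>z :: 'a::{finite, lattice}. \<forall>a. a \<le> z"
  by (meson Sup_fin.coboundedI UNIV_I finite)

section \<open>Birkhoff's representation by lower sets of join-irreducibles\<close>

text \<open>Distributivity writes such a \<open>p\<close> as the join of \<open>inf p a\<close> and
  \<open>inf p b\<close>, and irreducibility makes one of the two equal to \<open>p\<close>.\<close>

lemma join_irreducible_le_sup_iff: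
  assumes "join_irreducible p"
  shows "p \<le> sup a b \<longleftrightarrow> p \<le> a \<or> p \<le> b"
proof
  assume "p \<le> sup a b"
  then have "p = sup (inf p a) (inf p b)"
    by (metis inf.absorb1 inf_sup_distrib1)
  then have "p = inf p a \<or> p = inf p b"
    using assms unfolding join_irreducible_def by blast
  then show "p \<le> a \<or> p \<le> b"
    by (metis inf_le2)
qed (auto intro: le_supI1 le_supI2)

lemma birkhoff_mono: "a \<le> b \<Longrightarrow> birkhoff a \<subseteq> birkhoff b"
  by (auto simp: birkhoff_def)

lemma birkhoff_sup: "birkhoff (sup a b) = birkhoff a \<union> birkhoff b"
  by (auto simp: birkhoff_def join_irreducible_le_sup_iff)

lemma birkhoff_inf: "birkhoff (inf a b) = birkhoff a \<inter> birkhoff b"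
  by (auto simp: birkhoff_def)

lemma birkhoff_strict_mono: "a < b \<Longrightarrow> birkhoff a \<subset> birkhoff b"
  by (metis birkhoff_mono le_if_birkhoff_subset less_le_not_le psubsetI)

text \<open>The surjectivity half of Birkhoff's theorem. A lower set is the union of the sets
  \<open>birkhoff s\<close> of its members, and \<open>birkhoff\<close> turns joins into unions; the
  least element represents the empty union.\<close>

lemma ex_birkhoff_eq:
  fixes S :: "'a::{finite, distrib_lattice} set"
  assumes irr: "\<And>p. p \<in> S \<Longrightarrow> join_irreducible p"
    and low: "\<And>p q. p \<in> S \<Longrightarrow> join_irreducible q \<Longrightarrow> q < p \<Longrightarrow> q \<in> S"
  shows "\<exists>a. birkhoff a = S"
proof -
  have "\<exists>a. birkhoff a = (\<Union>s\<in>T. birkhoff s)" if "finite T" for T :: "'a set"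
    using that
  proof induction
    case empty
    obtain z :: 'a where z: "\<forall>a. z \<le> a"
      using finite_ex_least by blast
    have "\<not> (\<exists>b. b < p)" if "p \<le> z" for p
      using z that by (meson leD order.strict_trans2)
    then have "birkhoff z = {}"
      by (auto simp: birkhoff_def join_irreducible_def)
    then show ?case by auto
  next
    case (insert x T)
    then show ?case by (metis UN_insert birkhoff_sup)
  qed
  moreover have "(\<Union>s\<in>S. birkhoff s) = S"
  proof
    show "(\<Union>s\<in>S. birkhoff s) \<subseteq> S"
      using low by (force simp: birkhoff_def order_le_less)
    show "S \<subseteq> (\<Union>s\<in>S. birkhoff s)"
      using irr by (force simp: birkhoff_def)
  qed
  ultimately show ?thesis by (metis finite)
qed

section \<open>Chains and maximal chains\<close>

definition is_chain :: "'a::order set \<Rightarrow> bool" where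
  "is_chain C \<longleftrightarrow> (\<forall>a\<in>C. \<forall>b\<in>C. a \<le> b \<or> b \<le> a)"

definition maximal_chain :: "'a::order set \<Rightarrow> bool" where
  "maximal_chain C \<longleftrightarrow> is_chain C \<and> (\<forall>a. (\<forall>c\<in>C. a \<le> c \<or> c \<le> a) \<longrightarrow> a \<in> C)"

lemma is_chain_subset: "is_chain C \<Longrightarrow> B \<subseteq> C \<Longrightarrow> is_chain B"
  unfolding is_chain_def by blast

lemma is_chain_extend:
  fixes B :: "'a::{finite, order} set"
  assumes "is_chain B"
  shows "\<exists>C. maximal_chain C \<and> B \<subseteq> C"
proof -
  obtain C where C: "is_chain C" "B \<subseteq> C" and max: "\<And>D. is_chain D \<Longrightarrow> C \<subseteq> D \<Longrightarrow> C = D"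
    using finite_has_maximal2[of "{C. is_chain C}" B] assms by auto
  have "a \<in> C" if "\<forall>c\<in>C. a \<le> c \<or> c \<le> a" for a
  proof -
    have "is_chain (insert a C)"
      using that C(1) by (auto simp: is_chain_def)
    then show ?thesis using max[of "insert a C"] by blast
  qed
  then show ?thesis using C unfolding maximal_chain_def by blast
qed

lemma finite_chain_greatest:
  assumes "is_chain C" "finite C" "C \<noteq> {}"
  obtains m where "m \<in> C" "\<And>c. c \<in> C \<Longrightarrow> c \<le> m"
  using finite_has_maximal[of C] assms unfolding is_chain_def by metis

lemma finite_chain_least:
  assumes "is_chain C" "finite C" "C \<noteq> {}"
  obtains m where "m \<in> C" "\<And>c. c \<in> C \<Longrightarrow> m \<le> c"
  using finite_has_minimal[of C] assms unfolding is_chain_def by metis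

text \<open>Take \<open>c\<close> greatest in \<open>C\<close> below \<open>a\<close> and
  \<open>c'\<close> least in \<open>C\<close> not below \<open>a\<close>. Then
  \<open>inf a c'\<close> lies between these neighbours, hence is comparable with all of
  \<open>C\<close> and belongs to \<open>C\<close>; being below \<open>a\<close>, it is
  \<open>c\<close>. The modular relation for \<open>a\<close> and \<open>c'\<close> thus links
  \<open>a\<close> to two chain elements and to the strictly larger \<open>sup a c'\<close>, which
  drives inductions from the top.\<close>

lemma maximal_chain_step:
  fixes C :: "'a::{finite, distrib_lattice} set"
  assumes C: "maximal_chain C" and a: "a \<notin> C"
  obtains c c' where "c \<in> C" "c' \<in> C" "inf a c' = c" "\<not> a \<le> c'" "\<not> c' \<le> a"
proof -
  have ch: "is_chain C" and mx: "\<And>b. (\<forall>c\<in>C. b \<le> c \<or> c \<le> b) \<Longrightarrow> b \<in> C"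
    using C by (auto simp: maximal_chain_def)
  obtain z :: 'a where z: "\<forall>a. z \<le> a" using finite_ex_least by blast
  obtain t :: 'a where t: "\<forall>a. a \<le> t" using finite_ex_greatest by blast
  have zC: "z \<in> C" and tC: "t \<in> C" using z t mx by blast+
  have "is_chain {x \<in> C. x \<le> a}" "is_chain {x \<in> C. \<not> x \<le> a}"
    by (auto intro: is_chain_subset[OF ch])
  moreover have "z \<in> {x \<in> C. x \<le> a}" using z zC by blast
  moreover have "t \<in> {x \<in> C. \<not> x \<le> a}" using t tC a by (auto dest: order.antisym)
  ultimately obtain c c' where c: "c \<in> C" "c \<le> a" "\<And>x. x \<in> C \<Longrightarrow> x \<le> a \<Longrightarrow> x \<le> c"
    and c': "c' \<in> C" "\<not> c' \<le> a" "\<And>x. x \<in> C \<Longrightarrow> \<not> x \<le> a \<Longrightarrow> c' \<le> x"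
    by (metis (mono_tags, lifting) empty_iff finite finite_chain_greatest finite_chain_least
        mem_Collect_eq)
  have "c \<le> c'" using c c' ch unfolding is_chain_def by (metis order.trans)
  have "inf a c' \<in> C"
  proof (rule mx, rule ballI)
    fix x assume "x \<in> C"
    then show "inf a c' \<le> x \<or> x \<le> inf a c'"
      by (metis \<open>c \<le> c'\<close> c(2,3) c'(3) inf.bounded_iff inf_le2 order.trans)
  qed
  then have 1: "inf a c' = c"
    by (metis \<open>c \<le> c'\<close> c(2,3) inf.bounded_iff inf_le1 order.antisym)
  then have "\<not> a \<le> c'" using a c(1) by (metis inf.absorb1)
  then show thesis using that c(1) c'(1,2) 1 by blast
qed

section \<open>Homogenized vertices of the order polytope\<close>

text \<open>The extra coordinate 1 turns affine functions on the vertices into linear ones and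
  affine independence into linear independence.\<close>

definition hom_vertex :: "'a::{finite, distrib_lattice} \<Rightarrow> (real, 'a) vec \<times> real" where
  "hom_vertex a = (ideal_vertex a, 1)"

lemma ideal_vertex_nth: "ideal_vertex a $ p = (if p \<in> birkhoff a then 1 else 0)"
  by (simp add: ideal_vertex_def indicator_def)

lemma ideal_vertex_modular:
  "ideal_vertex (sup a b) + ideal_vertex (inf a b) = ideal_vertex a + ideal_vertex b"
  by (simp add: vec_eq_iff ideal_vertex_nth birkhoff_sup birkhoff_inf)

lemma hom_vertex_modular:
  "hom_vertex (sup a b) + hom_vertex (inf a b) = hom_vertex a + hom_vertex b"
  by (simp add: hom_vertex_def ideal_vertex_modular)

lemma inj_hom_vertex: "inj hom_vertex"
  using inj_ideal_vertex by (auto simp: inj_def hom_vertex_def)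

text \<open>Triangularity along the chain. Let \<open>m\<close> be the greatest element with nonzero
  coefficient. If it is the only one, the last coordinate gives a contradiction; otherwise a
  join-irreducible below \<open>m\<close> but not below the second greatest element is a coordinate
  that sees \<open>m\<close> alone.\<close>

lemma hom_vertex_chain_coeffs:
  fixes \<mu> :: "'a::{finite, distrib_lattice} \<Rightarrow> real"
  assumes "is_chain C" and zero: "(\<Sum>c\<in>C. \<mu> c *\<^sub>R hom_vertex c) = 0" and "c \<in> C"
  shows "\<mu> c = 0"
proof (rule ccontr)
  assume "\<mu> c \<noteq> 0"
  define S where "S = {c \<in> C. \<mu> c \<noteq> 0}"
  have sumS: "(\<Sum>c\<in>S. \<mu> c *\<^sub>R hom_vertex c) = 0"
    using zero unfolding S_def by (subst sum.mono_neutral_left[where T = C]) auto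
  have S: "is_chain S" "finite S" "S \<noteq> {}"
    using \<open>c \<in> C\<close> \<open>\<mu> c \<noteq> 0\<close> assms(1) by (auto simp: S_def intro: is_chain_subset)
  then obtain m where m: "m \<in> S" "\<And>c. c \<in> S \<Longrightarrow> c \<le> m"
    by (rule finite_chain_greatest) blast
  have snd0: "(\<Sum>c\<in>S. \<mu> c) = 0"
    using arg_cong[OF sumS, of snd] by (simp add: snd_sum hom_vertex_def)
  show False
  proof (cases "S = {m}")
    case True
    then have "\<mu> m = 0" using snd0 by simp
    then show False using m(1) by (simp add: S_def)
  next
    case False
    have "is_chain (S - {m})" "finite (S - {m})" "S - {m} \<noteq> {}"
      using S False m by (auto intro: is_chain_subset)
    then obtain m' where m': "m' \<in> S - {m}" "\<And>c. c \<in> S - {m} \<Longrightarrow> c \<le> m'"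
      by (rule finite_chain_greatest) blast
    then have "m' < m" using m by (auto simp: less_le)
    then obtain p where p: "p \<in> birkhoff m" "p \<notin> birkhoff m'"
      using birkhoff_strict_mono by blast
    have "p \<notin> birkhoff c" if "c \<in> S - {m}" for c
      using p(2) birkhoff_mono m'(2)[OF that] by blast
    then have "(\<Sum>c\<in>S. \<mu> c * ideal_vertex c $ p) = \<mu> m"
      by (subst sum.remove[OF S(2) m(1)]) (simp add: ideal_vertex_nth p)
    moreover have "(\<Sum>c\<in>S. \<mu> c * ideal_vertex c $ p) = 0"
      using arg_cong[OF sumS, of "\<lambda>z. fst z $ p"] by (simp add: fst_sum hom_vertex_def)
    ultimately show False using m(1) by (simp add: S_def)
  qed
qed

lemma independent_hom_vertex_chain:
  assumes "is_chain C"
  shows "independent (hom_vertex ` C)"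
proof -
  have "\<forall>v\<in>hom_vertex ` C. u v = 0" if "(\<Sum>v\<in>hom_vertex ` C. u v *\<^sub>R v) = 0" for u
  proof -
    have "(\<Sum>c\<in>C. u (hom_vertex c) *\<^sub>R hom_vertex c) = 0"
      using that by (simp add: sum.reindex inj_on_subset[OF inj_hom_vertex])
    then show ?thesis using hom_vertex_chain_coeffs[OF assms, of "\<lambda>c. u (hom_vertex c)"] by blast
  qed
  then show ?thesis by (auto simp: independent_explicit)
qed

lemma finite_upward_induct:
  assumes "\<And>a. (\<And>b. a < b \<Longrightarrow> P b) \<Longrightarrow> P (a :: 'a::{finite, order})"
  shows "P a"
proof (induction "card {b. a < b}" arbitrary: a rule: less_induct)
  case less
  have "card {c. b < c} < card {c. a < c}" if "a < b" for b
    by (rule psubset_card_mono) (use that in auto)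
  then show ?case using less assms by blast
qed

text \<open>For comparable \<open>a\<close>, \<open>b\<close> the two sides coincide, so strictness
  can only be asked of incomparable pairs.\<close>

definition strict_supermodular :: "(real, 'a::{finite, distrib_lattice}) vec \<Rightarrow> bool" where
  "strict_supermodular w \<longleftrightarrow>
    (\<forall>a b. \<not> a \<le> b \<and> \<not> b \<le> a \<longrightarrow> w $ a + w $ b < w $ (sup a b) + w $ (inf a b))"

text \<open>The difference \<open>w - g\<close> vanishes on \<open>C\<close>. If \<open>c'\<close> is the least element of \<open>C\<close> not below \<open>a\<close>, then
  \<open>a \<and> c' \<in> C\<close>, so supermodularity makes \<open>w - g\<close> strictly smaller at \<open>a\<close> than at \<open>a \<or> c' > a\<close>.\<close>

lemma strict_supermodular_support:
  assumes w: "strict_supermodular w" and C: "maximal_chain C"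
  obtains g where "linear g" "\<And>c. c \<in> C \<Longrightarrow> g (hom_vertex c) = w $ c"
    "\<And>a. a \<notin> C \<Longrightarrow> w $ a < g (hom_vertex a)"
proof -
  have "independent (hom_vertex ` C)"
    using C by (simp add: maximal_chain_def independent_hom_vertex_chain)
  \<comment> \<open>The values of \<open>w\<close> on the chain are transported along the injection
    \<open>hom_vertex\<close>; linear independence lets them extend to a linear
    \<open>g\<close>.\<close>
  from linear_independent_extend[OF this, of "\<lambda>z. w $ (inv hom_vertex z)"]
  obtain g where lin: "linear g" and g: "\<And>c. c \<in> C \<Longrightarrow> g (hom_vertex c) = w $ c"
    by (auto simp: inv_f_f[OF inj_hom_vertex])
  have "a \<notin> C \<longrightarrow> w $ a < g (hom_vertex a)" for a
  proof (induction a rule: finite_upward_induct)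
    case (1 a)
    show ?case
    proof
      assume "a \<notin> C"
      then obtain c c' where c: "c \<in> C" "c' \<in> C" "inf a c' = c" "\<not> a \<le> c'" "\<not> c' \<le> a"
        using maximal_chain_step[OF C] by blast
      then have "a < sup a c'"
        by (metis less_le sup.cobounded1 sup.cobounded2)
      then have "w $ (sup a c') \<le> g (hom_vertex (sup a c'))"
        using 1 g by (metis less_imp_le order_refl)
      moreover have "g (hom_vertex (sup a c')) + g (hom_vertex c) = g (hom_vertex a) + g (hom_vertex c')"
        using hom_vertex_modular[of a c'] c(3) by (metis lin linear_add)
      moreover have "w $ a + w $ c' < w $ (sup a c') + w $ c"
        using w c(3-5) unfolding strict_supermodular_def by blast
      ultimately show "w $ a < g (hom_vertex a)"
        using g c(1,2) by simp
    qed
  qed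
  then show thesis using that lin g by blast
qed

section \<open>The triangulation of the order polytope by maximal chains\<close>

text \<open>Layers are peeled off. The support of \<open>x\<close> is a lower set, hence some
  \<open>birkhoff a\<close>; subtracting the smallest nonzero coordinate times
  \<open>ideal_vertex a\<close> shrinks the support. The bound \<open>M\<close> is general because
  it drops with each layer. The clause on \<open>birkhoff c\<close> keeps all later elements below
  \<open>a\<close>, so that adding \<open>a\<close> leaves a chain.\<close>

lemma order_polytope_chain_decomposition:
  fixes x :: "(real, 'a::{finite, distrib_lattice}) vec"
  assumes "\<And>p. \<not> join_irreducible p \<Longrightarrow> x $ p = 0"
    and "\<And>p. 0 \<le> x $ p" and "\<And>p. x $ p \<le> M" and "0 \<le> M"
    and "\<And>p q. join_irreducible p \<Longrightarrow> join_irreducible q \<Longrightarrow> q < p \<Longrightarrow> x $ p \<le> x $ q"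
  shows "\<exists>\<mu>. (\<forall>c. 0 \<le> \<mu> c) \<and> is_chain {c. \<mu> c \<noteq> 0} \<and> (\<forall>c. \<mu> c \<noteq> 0 \<longrightarrow> birkhoff c \<subseteq> {p. x $ p \<noteq> 0})
    \<and> (\<Sum>c\<in>UNIV. \<mu> c *\<^sub>R ideal_vertex c) = x \<and> sum \<mu> UNIV = M"
  using assms
proof (induction "card {p. x $ p \<noteq> 0}" arbitrary: x M rule: less_induct)
  case less
  define S where "S = {p. x $ p \<noteq> 0}"
  have irr: "join_irreducible p" if "p \<in> S" for p
    using that less.prems(1) unfolding S_def by blast
  have "q \<in> S" if "p \<in> S" "join_irreducible q" "q < p" for p q
    using less.prems(5)[OF irr[OF that(1)] that(2,3)] less.prems(2)[of p] that(1)
    by (auto simp: S_def)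
  with irr obtain a where a: "birkhoff a = S"
    using ex_birkhoff_eq[of S] by blast
  show ?case
  proof (cases "S = {}")
    case True
    then have "x = 0" by (auto simp: S_def vec_eq_iff)
    have "ideal_vertex a = 0"
      using a True by (simp add: vec_eq_iff ideal_vertex_nth)
    \<comment> \<open>Here \<open>a\<close> is the least element and its vertex is the origin, so it
      can absorb the remaining weight \<open>M\<close> without moving the point.\<close>
    have "(\<Sum>c\<in>UNIV. (if c = a then M else 0) *\<^sub>R ideal_vertex c) = 0"
      by (intro sum.neutral) (simp add: \<open>ideal_vertex a = 0\<close>)
    then show ?thesis
      using True a \<open>x = 0\<close> less.prems(4)
      by (intro exI[of _ "\<lambda>c. if c = a then M else 0"]) (auto simp: is_chain_def)
  next
    case False
    define m where "m = Min ((\<lambda>p. x $ p) ` S)"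
    have "m \<in> (\<lambda>p. x $ p) ` S"
      unfolding m_def using False by (intro Min_in) auto
    then obtain p0 where p0: "p0 \<in> S" "x $ p0 = m" by auto
    have m_le: "m \<le> x $ p" if "p \<in> S" for p
      unfolding m_def using that by simp
    have "0 < m" using p0 less.prems(2)[of p0] by (auto simp: S_def)
    have "m \<le> M" using p0 less.prems(3) by auto
    \<comment> \<open>The coordinate \<open>p0\<close>, where the minimum \<open>m\<close> is
      attained, becomes zero, which makes the induction measure drop; all coordinates stay
      nonnegative and order-reversing.\<close>
    define y where "y = x - m *\<^sub>R ideal_vertex a"
    have y: "y $ p = (if p \<in> S then x $ p - m else 0)" for p
      by (simp add: y_def ideal_vertex_nth a) (simp add: S_def)
    have sub: "{p. y $ p \<noteq> 0} \<subseteq> S - {p0}"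
      by (auto simp: y p0 split: if_splits)
    then have card: "card {p. y $ p \<noteq> 0} < card {p. x $ p \<noteq> 0}"
      using p0 unfolding S_def[symmetric] by (intro psubset_card_mono) auto
    have "y $ p \<le> y $ q" if "join_irreducible p" "join_irreducible q" "q < p" for p q
      using less.prems(5)[OF that] less.prems(2)[of p] m_le[of q]
      by (auto simp: y S_def)
    moreover have "y $ p \<le> M - m" for p
      using less.prems(3)[of p] \<open>m \<le> M\<close> by (simp add: y)
    moreover have "0 \<le> y $ p" for p
      using m_le by (simp add: y)
    moreover have "y $ p = 0" if "\<not> join_irreducible p" for p
      using irr that by (auto simp: y)
    ultimately obtain \<mu> where \<mu>: "\<forall>c. 0 \<le> \<mu> c" "is_chain {c. \<mu> c \<noteq> 0}"
      "\<forall>c. \<mu> c \<noteq> 0 \<longrightarrow> birkhoff c \<subseteq> {p. y $ p \<noteq> 0}"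
      "(\<Sum>c\<in>UNIV. \<mu> c *\<^sub>R ideal_vertex c) = y" "sum \<mu> UNIV = M - m"
      using less.hyps[OF card, of "M - m"] \<open>m \<le> M\<close> by auto
    define \<nu> where "\<nu> = (\<lambda>c. \<mu> c + (if c = a then m else 0))"
    have \<nu>: "c = a \<or> \<mu> c \<noteq> 0" if "\<nu> c \<noteq> 0" for c
      using that by (auto simp: \<nu>_def split: if_splits)
    have sub': "birkhoff c \<subseteq> S" if "\<nu> c \<noteq> 0" for c
      using \<nu>[OF that] \<mu>(3) sub a by blast
    have le_a: "c \<le> a" if "\<nu> c \<noteq> 0" for c
      using sub'[OF that] unfolding a[symmetric] by (rule le_if_birkhoff_subset)
    have "b \<le> c \<or> c \<le> b" if "\<nu> b \<noteq> 0" "\<nu> c \<noteq> 0" for b c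
      using \<nu>[OF that(1)] \<nu>[OF that(2)] le_a[OF that(1)] le_a[OF that(2)] \<mu>(2)
      by (auto simp: is_chain_def)
    then have "is_chain {c. \<nu> c \<noteq> 0}"
      by (simp add: is_chain_def)
    moreover have "(\<Sum>c\<in>UNIV. (if c = a then m else 0) *\<^sub>R ideal_vertex c) = m *\<^sub>R ideal_vertex a"
      by (simp add: if_distrib[of "\<lambda>t. t *\<^sub>R _"] cong: if_cong)
    then have "(\<Sum>c\<in>UNIV. \<nu> c *\<^sub>R ideal_vertex c) = x"
      by (simp add: \<nu>_def scaleR_left_distrib sum.distrib \<mu>(4) y_def)
    moreover have "sum \<nu> UNIV = M"
      by (simp add: \<nu>_def sum.distrib \<mu>(5))
    moreover have "0 \<le> \<nu> c" for c
      using \<mu>(1) \<open>0 < m\<close> by (simp add: \<nu>_def)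
    ultimately show ?thesis
      using sub' unfolding S_def by blast
  qed
qed

text \<open>The chain from the decomposition with \<open>M = 1\<close> is enlarged to a maximal one
  by zero weights. This covering later excludes cells other than chain simplices.\<close>

lemma order_polytope_chain_cover:
  assumes "x \<in> order_polytope"
  shows "\<exists>C. maximal_chain C \<and> x \<in> convex hull (ideal_vertex ` C)"
proof -
  have "0 \<le> x $ p" "x $ p \<le> 1" for p
    using assms by (cases "join_irreducible p"; auto simp: order_polytope_def)+
  then obtain \<mu> where \<mu>: "\<forall>c. 0 \<le> \<mu> c" "is_chain {c. \<mu> c \<noteq> 0}"
      "(\<Sum>c\<in>UNIV. \<mu> c *\<^sub>R ideal_vertex c) = x" "sum \<mu> UNIV = 1"
    using order_polytope_chain_decomposition[of x 1] assms by (auto simp: order_polytope_def)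
  then obtain C where C: "maximal_chain C" "{c. \<mu> c \<noteq> 0} \<subseteq> C"
    using is_chain_extend by blast
  have sums: "sum \<mu> C = sum \<mu> UNIV"
    "(\<Sum>c\<in>C. \<mu> c *\<^sub>R ideal_vertex c) = (\<Sum>c\<in>UNIV. \<mu> c *\<^sub>R ideal_vertex c)"
    using C by (auto intro!: sum.mono_neutral_left)
  then have "(\<Sum>c\<in>C. \<mu> c *\<^sub>R ideal_vertex c) \<in> convex hull (ideal_vertex ` C)"
    using \<mu> sums(1) by (intro convex_sum) (auto intro: hull_inc)
  then show ?thesis
    using C \<mu> sums(2) by auto
qed

section \<open>The order polytope as the hull of its vertices\<close>

lemma convex_order_polytope: "convex order_polytope"
proof (rule convexI)
  fix x y :: "(real, 'a) vec" and u v :: real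
  assume "x \<in> order_polytope" "y \<in> order_polytope" and uv: "0 \<le> u" "0 \<le> v" "u + v = 1"
  then have x: "\<not> join_irreducible p \<Longrightarrow> x $ p = 0" "\<not> join_irreducible p \<Longrightarrow> y $ p = 0"
    "join_irreducible p \<Longrightarrow> 0 \<le> x $ p" "join_irreducible p \<Longrightarrow> 0 \<le> y $ p"
    "join_irreducible p \<Longrightarrow> x $ p \<le> 1" "join_irreducible p \<Longrightarrow> y $ p \<le> 1"
    "join_irreducible p \<Longrightarrow> join_irreducible q \<Longrightarrow> q < p \<Longrightarrow> x $ p \<le> x $ q"
    "join_irreducible p \<Longrightarrow> join_irreducible q \<Longrightarrow> q < p \<Longrightarrow> y $ p \<le> y $ q" for p q
    by (auto simp: order_polytope_def)
  have "u * x $ p + v * y $ p \<le> 1" if "join_irreducible p" for p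
    using convex_bound_le[OF x(5,6) uv] that by simp
  then show "u *\<^sub>R x + v *\<^sub>R y \<in> order_polytope"
    using x uv by (auto simp: order_polytope_def intro!: add_mono mult_left_mono)
qed

lemma ideal_vertex_in_order_polytope: "ideal_vertex a \<in> order_polytope"
  by (auto simp: order_polytope_def ideal_vertex_nth birkhoff_def)

lemma order_polytope_eq:
  "order_polytope = convex hull (range (ideal_vertex :: 'a::{finite, distrib_lattice} \<Rightarrow> _))"
    (is "?L = ?R")
proof
  show "?L \<subseteq> ?R"
  proof
    fix x :: "(real, 'a) vec" assume "x \<in> order_polytope"
    from order_polytope_chain_cover[OF this] obtain C where "x \<in> convex hull (ideal_vertex ` C)"
      by blast
    then show "x \<in> ?R"
      using hull_mono[of "ideal_vertex ` C" "range ideal_vertex" convex] by blast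
  qed
  show "?R \<subseteq> ?L"
    by (intro hull_minimal convex_order_polytope) (auto simp: ideal_vertex_in_order_polytope)
qed

text \<open>In each coordinate a proper convex combination of numbers in the unit interval reaches 0
  or 1 only if both numbers already have that value.\<close>

lemma zero_one_extreme_point_of_cube:
  fixes S :: "(real, 'n::finite) vec set"
  assumes S: "\<And>x i. x \<in> S \<Longrightarrow> 0 \<le> x $ i \<and> x $ i \<le> 1"
    and v: "v \<in> S" "\<And>i. v $ i = 0 \<or> v $ i = 1"
  shows "v extreme_point_of S"
  unfolding extreme_point_of_def
proof (intro conjI ballI notI)
  fix a b assume ab: "a \<in> S" "b \<in> S" and "v \<in> open_segment a b"
  then obtain u where u: "0 < u" "u < 1" "v = (1 - u) *\<^sub>R a + u *\<^sub>R b" and "a \<noteq> b"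
    by (auto simp: in_segment)
  have "a $ i = b $ i" for i
  proof -
    have vi: "v $ i = (1 - u) * a $ i + u * b $ i" by (simp add: u)
    show ?thesis
    proof (cases "v $ i = 0")
      case True
      moreover have "0 \<le> (1 - u) * a $ i" "0 \<le> u * b $ i" using u S ab by auto
      ultimately have "(1 - u) * a $ i = 0" "u * b $ i = 0" using vi by linarith+
      then show ?thesis using u by simp
    next
      case False
      then have "(1 - u) * (1 - a $ i) + u * (1 - b $ i) = 0"
        using v(2)[of i] vi by (simp add: algebra_simps)
      moreover have "0 \<le> (1 - u) * (1 - a $ i)" "0 \<le> u * (1 - b $ i)" using u S ab by auto
      ultimately have "(1 - u) * (1 - a $ i) = 0" "u * (1 - b $ i) = 0" by linarith+
      then show ?thesis using u by simp
    qed
  qed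
  then show False using \<open>a \<noteq> b\<close> by (simp add: vec_eq_iff)
qed (fact v)

lemma vertices_order_polytope:
  "vertices order_polytope = range (ideal_vertex :: 'a::{finite, distrib_lattice} \<Rightarrow> _)"
    (is "?L = ?R")
proof
  show "?L \<subseteq> ?R"
    unfolding vertices_def order_polytope_eq using extreme_point_of_convex_hull by blast
  have bnd: "0 \<le> x $ i \<and> x $ i \<le> 1" if "x \<in> order_polytope" for x :: "(real, 'a) vec" and i
    using that by (cases "join_irreducible i") (auto simp: order_polytope_def)
  show "?R \<subseteq> ?L"
    unfolding vertices_def
    by (auto intro!: zero_one_extreme_point_of_cube[OF bnd ideal_vertex_in_order_polytope]
        simp: ideal_vertex_nth)
qed

section \<open>Initial ideals of the Hibi ideal\<close>

lemma module_times: "module ((*) :: 'b::comm_ring_1 \<Rightarrow> 'b \<Rightarrow> 'b)"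
  by unfold_locales (auto simp: algebra_simps)

lemma module_complex: "module (\<lambda>z (p :: 'a poly_ring). Poly_Mapping.single 0 z * p)"
  by unfold_locales
    (simp_all add: distrib_left distrib_right single_add mult_single mult.assoc[symmetric])

lemma poly_mapping_sum_single:
  "p = (\<Sum>m\<in>Poly_Mapping.keys p. Poly_Mapping.single m (Poly_Mapping.lookup p m))"
  by (rule poly_mapping_eqI)
    (auto simp: lookup_sum lookup_single when_def in_keys_iff sum.delta'[OF finite_keys])

text \<open>A polynomial multiplier is a complex combination of monomials, so monomial multiples of
  the generators suffice. Membership questions for ideals thereby become linear algebra over the
  complex numbers.\<close>

lemma ideal_gen_eq_complex_span:
  "ideal_gen S = complex_span {Poly_Mapping.single m 1 * s | m s. s \<in> S}" (is "_ = complex_span ?M")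
proof
  interpret R: module "(*) :: 'a poly_ring \<Rightarrow> _" by (rule module_times)
  interpret K: module "\<lambda>z (p :: 'a poly_ring). Poly_Mapping.single 0 z * p" by (rule module_complex)
  have mono: "Poly_Mapping.single m c * x \<in> K.span ?M" if "x \<in> K.span ?M" for m c x
    using that
  proof (induction rule: K.span_induct_alt)
    case base
    then show ?case by (simp add: K.span_zero)
  next
    case (step z y x)
    from step(1) obtain m' s where y: "y = Poly_Mapping.single m' 1 * s" "s \<in> S" by blast
    have "Poly_Mapping.single (m + m') 1 * s \<in> K.span ?M"
      using y(2) by (intro K.span_base) blast
    from K.span_scale[OF this, of "c * z"]
    have "Poly_Mapping.single m c * (Poly_Mapping.single 0 z * y) \<in> K.span ?M"
      by (simp add: y mult.assoc[symmetric] mult_single)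
    then show ?case using step by (simp add: distrib_left K.span_add)
  qed
  have "r * x \<in> K.span ?M" if "x \<in> K.span ?M" for r x
  proof -
    have "r * x = (\<Sum>m\<in>Poly_Mapping.keys r. Poly_Mapping.single m (Poly_Mapping.lookup r m) * x)"
      by (subst poly_mapping_sum_single[of r]) (simp add: sum_distrib_right)
    then show ?thesis using mono[OF that] by (simp add: K.span_sum)
  qed
  then have "R.subspace (K.span ?M)"
    by (auto simp: R.subspace_def K.span_zero K.span_add)
  moreover have "s \<in> K.span ?M" if "s \<in> S" for s
  proof -
    have "Poly_Mapping.single 0 1 * s \<in> K.span ?M" using that by (intro K.span_base) blast
    then show ?thesis by simp
  qed
  ultimately show "ideal_gen S \<subseteq> complex_span ?M"
    unfolding ideal_gen_def complex_span_def by (intro R.span_minimal) auto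
  have "K.subspace (R.span S)"
    by (auto simp: K.subspace_def R.span_zero R.span_add R.span_scale)
  moreover have "?M \<subseteq> R.span S"
    by (auto intro: R.span_scale R.span_base)
  ultimately show "complex_span ?M \<subseteq> ideal_gen S"
    unfolding ideal_gen_def complex_span_def by (intro K.span_minimal)
qed

lemma complex_span_subset:
  assumes "S \<subseteq> T" "0 \<in> T" "\<And>p q. p \<in> T \<Longrightarrow> q \<in> T \<Longrightarrow> p + q \<in> T"
    "\<And>z p. p \<in> T \<Longrightarrow> Poly_Mapping.single 0 z * p \<in> T"
  shows "complex_span S \<subseteq> T"
proof -
  interpret K: module "\<lambda>z (p :: 'a poly_ring). Poly_Mapping.single 0 z * p" by (rule module_complex)
  show ?thesis
    unfolding complex_span_def using assms by (intro K.span_minimal) (auto simp: K.subspace_def)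
qed

lemma lookup_const_times:
  "Poly_Mapping.lookup (Poly_Mapping.single 0 z * (p :: 'a poly_ring)) m = z * Poly_Mapping.lookup p m"
proof -
  have "Poly_Mapping.single 0 z * p
      = (\<Sum>m\<in>Poly_Mapping.keys p. Poly_Mapping.single m (z * Poly_Mapping.lookup p m))"
    by (subst poly_mapping_sum_single[of p]) (simp add: sum_distrib_left mult_single)
  then show ?thesis
    by (simp add: lookup_sum lookup_single when_def in_keys_iff sum.delta'[OF finite_keys])
qed

lemma indet_times_indet:
  "indet a * indet b = Poly_Mapping.single (Poly_Mapping.single a 1 + Poly_Mapping.single b 1) 1"
  by (simp add: indet_def mult_single)

lemma keys_add_nat:
  "Poly_Mapping.keys (m + n) = Poly_Mapping.keys m \<union> Poly_Mapping.keys (n :: 'a \<Rightarrow>\<^sub>0 nat)"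
  by (auto simp: in_keys_iff lookup_add)

text \<open>The witness is a truncated difference of natural exponents. It is exact because
  \<open>a\<close> and \<open>b\<close> are distinct and each has exponent at least 1 in
  \<open>m\<close>.\<close>

lemma exponent_split:
  fixes m :: "'a \<Rightarrow>\<^sub>0 nat"
  assumes "a \<in> Poly_Mapping.keys m" "b \<in> Poly_Mapping.keys m" "a \<noteq> b"
  obtains n where "m = n + (Poly_Mapping.single a 1 + Poly_Mapping.single b 1)"
proof
  show "m = (m - (Poly_Mapping.single a 1 + Poly_Mapping.single b 1))
      + (Poly_Mapping.single a 1 + Poly_Mapping.single b 1)"
    using assms
    by (intro poly_mapping_eqI)
      (auto simp: lookup_add lookup_minus lookup_single when_def in_keys_iff)
qed

text \<open>This is a monomial ideal, so membership is tested monomial by monomial, and a monomial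
  is divisible by a generator exactly when its support contains an incomparable pair. The monomials
  outside are the standard monomials, those supported on chains.\<close>

lemma incomparable_ideal_iff:
  "p \<in> incomparable_ideal \<longleftrightarrow> (\<forall>m\<in>Poly_Mapping.keys p. \<not> is_chain (Poly_Mapping.keys m))"
proof
  interpret K: module "\<lambda>z (p :: 'a poly_ring). Poly_Mapping.single 0 z * p" by (rule module_complex)
  let ?T = "{p :: 'a poly_ring. \<forall>m\<in>Poly_Mapping.keys p. \<not> is_chain (Poly_Mapping.keys m)}"
  let ?M = "{Poly_Mapping.single m 1 * s | m s. s \<in> {indet a * indet b | a b :: 'a. \<not> a \<le> b \<and> \<not> b \<le> a}}"
  have "complex_span ?M \<subseteq> ?T"
  proof (rule complex_span_subset)
    show "?M \<subseteq> ?T"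
      by (auto simp: indet_times_indet mult_single keys_add_nat is_chain_def)
    show "p + q \<in> ?T" if "p \<in> ?T" "q \<in> ?T" for p q
      using that keys_add[of p q] by auto
    show "Poly_Mapping.single 0 z * p \<in> ?T" if "p \<in> ?T" for z p
      using that by (auto simp: in_keys_iff lookup_const_times)
  qed auto
  then show "p \<in> incomparable_ideal \<Longrightarrow> \<forall>m\<in>Poly_Mapping.keys p. \<not> is_chain (Poly_Mapping.keys m)"
    unfolding incomparable_ideal_def ideal_gen_eq_complex_span by blast
  assume *: "\<forall>m\<in>Poly_Mapping.keys p. \<not> is_chain (Poly_Mapping.keys m)"
  have "Poly_Mapping.single m c \<in> K.span ?M" if "\<not> is_chain (Poly_Mapping.keys m)" for m c
  proof -
    from that obtain a b where ab: "a \<in> Poly_Mapping.keys m" "b \<in> Poly_Mapping.keys m"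
      "\<not> a \<le> b" "\<not> b \<le> a" by (auto simp: is_chain_def)
    then obtain n where "m = n + (Poly_Mapping.single a 1 + Poly_Mapping.single b 1)"
      by (metis exponent_split order_refl)
    then have "Poly_Mapping.single m c
        = Poly_Mapping.single 0 c * (Poly_Mapping.single n 1 * (indet a * indet b))"
      by (simp add: indet_times_indet mult_single)
    moreover have "Poly_Mapping.single n 1 * (indet a * indet b) \<in> K.span ?M"
      using ab by (intro K.span_base) blast
    ultimately show ?thesis by (simp only: K.span_scale)
  qed
  then have "(\<Sum>m\<in>Poly_Mapping.keys p. Poly_Mapping.single m (Poly_Mapping.lookup p m)) \<in> K.span ?M"
    using * by (intro K.span_sum) blast
  then show "p \<in> incomparable_ideal"
    unfolding incomparable_ideal_def ideal_gen_eq_complex_span complex_span_def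
    by (simp flip: poly_mapping_sum_single)
qed

section \<open>The fine grading of the Hibi ring\<close>

text \<open>The exponent of the image of a monomial in the Hibi ring; its last coordinate is the
  total degree.\<close>

definition hom_degree :: "('a::{finite, distrib_lattice} \<Rightarrow>\<^sub>0 nat) \<Rightarrow> (real, 'a) vec \<times> real" where
  "hom_degree m = (\<Sum>a\<in>UNIV. real (Poly_Mapping.lookup m a) *\<^sub>R hom_vertex a)"

lemma hom_degree_add: "hom_degree (m + n) = hom_degree m + hom_degree n"
  by (simp add: hom_degree_def lookup_add scaleR_left_distrib sum.distrib)

lemma hom_degree_single: "hom_degree (Poly_Mapping.single a 1) = hom_vertex a"
  by (simp add: hom_degree_def lookup_single when_def if_distrib[of real] if_distrib[of "\<lambda>t. t *\<^sub>R _"]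
      cong: if_cong)

lemma grading_add: "grading w (m + n) = grading w m + grading w n"
  by (simp add: grading_def lookup_add distrib_right sum.distrib)

lemma grading_single: "grading w (Poly_Mapping.single a 1) = w $ a"
  by (simp add: grading_def lookup_single when_def if_distrib[of real] if_distrib[of "\<lambda>t. t * _"]
      cong: if_cong)

text \<open>The coefficients of the image of \<open>p\<close> under the homomorphism
  \<open>X\<^sub>a \<mapsto> x\<close> to the power \<open>hom_vertex a\<close>, whose kernel contains the Hibi ideal.\<close>

definition fiber_sum :: "(real, 'a) vec \<times> real \<Rightarrow> 'a::{finite, distrib_lattice} poly_ring \<Rightarrow> complex" where
  "fiber_sum z p = (\<Sum>m\<in>{m \<in> Poly_Mapping.keys p. hom_degree m = z}. Poly_Mapping.lookup p m)"

lemma fiber_sum_superset: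
  assumes "finite A" "Poly_Mapping.keys p \<subseteq> A"
  shows "fiber_sum z p = (\<Sum>m\<in>{m \<in> A. hom_degree m = z}. Poly_Mapping.lookup p m)"
  unfolding fiber_sum_def using assms by (intro sum.mono_neutral_left) (auto simp: in_keys_iff)

lemma fiber_sum_add: "fiber_sum z (p + q) = fiber_sum z p + fiber_sum z q"
proof -
  let ?A = "Poly_Mapping.keys p \<union> Poly_Mapping.keys q"
  have "fiber_sum z r = (\<Sum>m\<in>{m \<in> ?A. hom_degree m = z}. Poly_Mapping.lookup r m)"
    if "r \<in> {p, q, p + q}" for r
    using that keys_add[of p q] by (intro fiber_sum_superset) auto
  then show ?thesis by (simp add: lookup_add sum.distrib)
qed

lemma fiber_sum_const_times: "fiber_sum z (Poly_Mapping.single 0 c * p) = c * fiber_sum z p"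
proof -
  have "fiber_sum z (Poly_Mapping.single 0 c * p)
     = (\<Sum>m\<in>{m \<in> Poly_Mapping.keys p. hom_degree m = z}. c * Poly_Mapping.lookup p m)"
    by (subst fiber_sum_superset[of "Poly_Mapping.keys p"])
      (auto simp: lookup_const_times in_keys_iff)
  then show ?thesis by (simp add: fiber_sum_def sum_distrib_left)
qed

lemma fiber_sum_single: "fiber_sum z (Poly_Mapping.single m c) = (if hom_degree m = z then c else 0)"
proof -
  have "{m' \<in> {m}. hom_degree m' = z} = (if hom_degree m = z then {m} else {})" by auto
  then show ?thesis by (subst fiber_sum_superset[of "{m}"]) auto
qed

text \<open>A monomial times a generator is a difference of two monomials, whose
  \<open>hom_degree\<close> agrees by the modular relation, so their contributions cancel; the fiber
  sum is linear in \<open>p\<close>.\<close>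

lemma fiber_sum_hibi_ideal:
  assumes "p \<in> hibi_ideal"
  shows "fiber_sum z p = 0"
proof -
  have "complex_span {Poly_Mapping.single m 1 * s | m s.
      s \<in> {indet a * indet b - indet (sup a b) * indet (inf a b) | a b :: 'a. True}}
    \<subseteq> {p. fiber_sum z p = 0}"
  proof (rule complex_span_subset; clarsimp simp: fiber_sum_add fiber_sum_const_times)
    show "fiber_sum z 0 = 0" by (simp add: fiber_sum_def)
    fix m :: "'a \<Rightarrow>\<^sub>0 nat" and a b
    let ?f = "\<lambda>a b. m + (Poly_Mapping.single a 1 + Poly_Mapping.single b 1)"
    have "Poly_Mapping.single m 1 * (indet a * indet b - indet (sup a b) * indet (inf a b))
      = Poly_Mapping.single (?f a b) 1 + Poly_Mapping.single (?f (sup a b) (inf a b)) (- 1)"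
      by (simp add: indet_times_indet algebra_simps mult_single single_uminus)
    moreover have "hom_degree (?f (sup a b) (inf a b)) = hom_degree (?f a b)"
      unfolding hom_degree_add hom_degree_single by (simp add: hom_vertex_modular)
    ultimately show "fiber_sum z (Poly_Mapping.single m 1
        * (indet a * indet b - indet (sup a b) * indet (inf a b))) = 0"
      by (simp add: fiber_sum_add fiber_sum_single)
  qed
  then show ?thesis using assms unfolding hibi_ideal_def ideal_gen_eq_complex_span by blast
qed

text \<open>Let \<open>g\<close> support \<open>w\<close> along a maximal chain containing the
  support of \<open>m\<close>. The grading of any monomial is at most \<open>g\<close> of its
  \<open>hom_degree\<close>, with equality for \<open>m\<close> and strict inequality once a
  variable outside the chain occurs.\<close>

lemma grading_less_standard:
  assumes w: "strict_supermodular w" and m: "is_chain (Poly_Mapping.keys m)"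
    and eq: "hom_degree m' = hom_degree m" and "m' \<noteq> m"
  shows "grading w m' < grading w m"
proof -
  obtain C where C: "maximal_chain C" "Poly_Mapping.keys m \<subseteq> C"
    using is_chain_extend[OF m] by blast
  obtain g where g: "linear g" "\<And>c. c \<in> C \<Longrightarrow> g (hom_vertex c) = w $ c"
    "\<And>a. a \<notin> C \<Longrightarrow> w $ a < g (hom_vertex a)"
    using strict_supermodular_support[OF w C(1)] by blast
  let ?l = Poly_Mapping.lookup
  have gdeg: "g (hom_degree n) = (\<Sum>a\<in>UNIV. real (?l n a) * g (hom_vertex a))" for n
    by (simp add: hom_degree_def linear_sum[OF g(1)] linear_scale[OF g(1)])
  have "real (?l m a) * w $ a = real (?l m a) * g (hom_vertex a)" for a
    using g(2)[of a] C(2) by (cases "a \<in> C") (auto simp: in_keys_iff)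
  then have eqm: "grading w m = g (hom_degree m)"
    unfolding grading_def gdeg by (rule sum.cong[OF refl])
  have le: "real (?l m' a) * w $ a \<le> real (?l m' a) * g (hom_vertex a)" for a
    using g(2,3)[of a] by (cases "a \<in> C") (auto intro: mult_left_mono)
  \<comment> \<open>If \<open>m'\<close> were also supported on \<open>C\<close>, linear
    independence along \<open>C\<close> would recover its exponents from \<open>hom_degree\<close>
    and give \<open>m' = m\<close>.\<close>
  have "\<exists>a. a \<notin> C \<and> a \<in> Poly_Mapping.keys m'"
  proof (rule ccontr)
    assume "\<nexists>a. a \<notin> C \<and> a \<in> Poly_Mapping.keys m'"
    then have m': "Poly_Mapping.keys m' \<subseteq> C" by blast
    have degC: "hom_degree n = (\<Sum>a\<in>C. real (?l n a) *\<^sub>R hom_vertex a)"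
      if "Poly_Mapping.keys n \<subseteq> C" for n
      unfolding hom_degree_def using that by (intro sum.mono_neutral_right) (auto simp: in_keys_iff)
    have "(\<Sum>a\<in>C. (real (?l m' a) - real (?l m a)) *\<^sub>R hom_vertex a) = 0"
      using eq degC[OF m'] degC[OF C(2)] by (simp add: scaleR_left_diff_distrib sum_subtractf)
    then have "real (?l m' a) - real (?l m a) = 0" if "a \<in> C" for a
      using hom_vertex_chain_coeffs[of C "\<lambda>a. real (?l m' a) - real (?l m a)"] C(1) that
      by (simp add: maximal_chain_def)
    moreover have "?l m' a = 0" "?l m a = 0" if "a \<notin> C" for a
      using m' C(2) that by (auto simp: in_keys_iff)
    ultimately have "?l m' a = ?l m a" for a
      by (cases "a \<in> C") auto
    then have "m' = m" by (intro poly_mapping_eqI)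
    then show False using \<open>m' \<noteq> m\<close> by simp
  qed
  then obtain a where "a \<notin> C" "?l m' a > 0" by (auto simp: in_keys_iff)
  then have "real (?l m' a) * w $ a < real (?l m' a) * g (hom_vertex a)"
    using g(3) by simp
  then have "grading w m' < g (hom_degree m')"
    unfolding grading_def gdeg using le by (intro sum_strict_mono_ex1) auto
  then show ?thesis using eq eqm by simp
qed

section \<open>Initial forms and the cone of the Hibi ideal\<close>

lemma lookup_homogeneous_component:
  "Poly_Mapping.lookup (homogeneous_component w d p) m =
    (if grading w m = d then Poly_Mapping.lookup p m else 0)"
proof -
  let ?A = "{m \<in> Poly_Mapping.keys p. grading w m = d}"
  have "Poly_Mapping.lookup (homogeneous_component w d p) m
      = (\<Sum>n\<in>?A. if n = m then Poly_Mapping.lookup p n else 0)"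
    by (simp add: homogeneous_component_def lookup_sum lookup_single when_def)
  also have "\<dots> = (if m \<in> ?A then Poly_Mapping.lookup p m else 0)"
    by (rule sum.delta) simp
  finally show ?thesis by (auto simp: in_keys_iff)
qed

lemma lookup_initial_form:
  "Poly_Mapping.lookup (initial_form w p) m =
    (if grading w m = Min (grading w ` Poly_Mapping.keys p) then Poly_Mapping.lookup p m else 0)"
  by (simp only: initial_form_def lookup_homogeneous_component)

lemma keys_binomial:
  assumes "m \<noteq> n"
  shows "Poly_Mapping.keys (Poly_Mapping.single m 1 - Poly_Mapping.single n 1 :: 'a poly_ring) = {m, n}"
  using assms by (auto simp: in_keys_iff lookup_minus lookup_single when_def split: if_splits)

lemma initial_form_binomial:
  assumes "grading w m < grading w n"
  shows "initial_form w (Poly_Mapping.single m 1 - Poly_Mapping.single n 1) = Poly_Mapping.single m 1"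
proof -
  have "m \<noteq> n" using assms by auto
  have "Min (grading w ` {m, n}) = grading w m" using assms by simp
  then show ?thesis
    using assms \<open>m \<noteq> n\<close>
    by (intro poly_mapping_eqI)
      (auto simp: lookup_initial_form keys_binomial lookup_minus lookup_single when_def)
qed

text \<open>Necessity comes from the initial forms of the generating binomials. For sufficiency, a
  chain monomial in an initial form would be alone in its fiber, contradicting the vanishing fiber
  sum; conversely every nonchain monomial is the initial form of a monomial multiple of a
  generator.\<close>

theorem initial_cone_hibi_incomparable:
  "initial_cone hibi_ideal incomparable_ideal = Collect strict_supermodular"
proof (intro equalityI subsetI)
  fix w :: "(real, 'a) vec"
  assume "w \<in> initial_cone hibi_ideal incomparable_ideal"
  then have J: "initial_ideal w hibi_ideal = incomparable_ideal" by (simp add: initial_cone_def)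
  interpret R: module "(*) :: 'a poly_ring \<Rightarrow> _" by (rule module_times)
  interpret K: module "\<lambda>z (p :: 'a poly_ring). Poly_Mapping.single 0 z * p" by (rule module_complex)
  have "w $ a + w $ b < w $ (sup a b) + w $ (inf a b)" if inc: "\<not> a \<le> b" "\<not> b \<le> a" for a b
  proof (rule ccontr)
    assume ge: "\<not> w $ a + w $ b < w $ (sup a b) + w $ (inf a b)"
    let ?m = "Poly_Mapping.single a 1 + Poly_Mapping.single b (1::nat)"
    let ?n = "Poly_Mapping.single (sup a b) 1 + Poly_Mapping.single (inf a b) (1::nat)"
    let ?f = "Poly_Mapping.single ?m 1 - Poly_Mapping.single ?n 1 :: 'a poly_ring"
    have chain: "is_chain (Poly_Mapping.keys ?n)"
      by (auto simp: keys_add_nat is_chain_def intro: le_infI1 le_supI1)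
    have "\<not> is_chain (Poly_Mapping.keys ?m)"
      using inc by (auto simp: keys_add_nat is_chain_def)
    with chain have mn: "?m \<noteq> ?n" by metis
    have "?f \<in> hibi_ideal"
      unfolding hibi_ideal_def ideal_gen_def indet_times_indet by (intro R.span_base) blast
    moreover have "?f \<noteq> 0"
      using keys_binomial[OF mn] by (metis keys_zero insert_not_empty)
    ultimately have "initial_form w ?f \<in> incomparable_ideal"
      unfolding J[symmetric] initial_ideal_def complex_span_def by (intro K.span_base) blast
    \<comment> \<open>By \<open>ge\<close> the monomial \<open>?n\<close> has least grading; in case
      of a tie the initial form is the whole binomial and still contains it.\<close>
    moreover have "?n \<in> Poly_Mapping.keys (initial_form w ?f)"
      using ge mn
      by (simp add: in_keys_iff lookup_initial_form keys_binomial grading_add grading_single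
          lookup_minus lookup_single min_def del: One_nat_def)
    ultimately show False using chain unfolding incomparable_ideal_iff by blast
  qed
  then show "w \<in> Collect strict_supermodular" by (simp add: strict_supermodular_def)
next
  fix w :: "(real, 'a) vec"
  assume "w \<in> Collect strict_supermodular"
  then have w: "strict_supermodular w" by simp
  interpret R: module "(*) :: 'a poly_ring \<Rightarrow> _" by (rule module_times)
  interpret K: module "\<lambda>z (p :: 'a poly_ring). Poly_Mapping.single 0 z * p" by (rule module_complex)
  let ?I = "{initial_form w p | p. p \<in> hibi_ideal \<and> p \<noteq> 0}"
  have "initial_form w p \<in> incomparable_ideal" if p: "p \<in> hibi_ideal" for p
    unfolding incomparable_ideal_iff
  proof (intro ballI notI)
    fix m assume "m \<in> Poly_Mapping.keys (initial_form w p)" and chain: "is_chain (Poly_Mapping.keys m)"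
    then have min: "grading w m = Min (grading w ` Poly_Mapping.keys p)" and m: "m \<in> Poly_Mapping.keys p"
      by (auto simp: in_keys_iff lookup_initial_form split: if_splits)
    let ?F = "{m' \<in> Poly_Mapping.keys p. hom_degree m' = hom_degree m}"
    \<comment> \<open>Another monomial of \<open>p\<close> in the same fiber would have smaller
      grading than \<open>m\<close>, whereas \<open>m\<close> attains the minimum over
      \<open>p\<close>.\<close>
    have "?F = {m}"
    proof (rule ccontr)
      assume "?F \<noteq> {m}"
      with m obtain m' where m': "m' \<in> Poly_Mapping.keys p" "hom_degree m' = hom_degree m" "m' \<noteq> m"
        by blast
      then have "grading w m' < grading w m" using grading_less_standard[OF w chain] by blast
      moreover have "grading w m \<le> grading w m'" unfolding min using m'(1) by simp
      ultimately show False by simp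
    qed
    then have "fiber_sum (hom_degree m) p = Poly_Mapping.lookup p m"
      by (simp add: fiber_sum_def)
    then show False using fiber_sum_hibi_ideal[OF p] m by (simp add: in_keys_iff)
  qed
  then have "complex_span ?I \<subseteq> incomparable_ideal"
    unfolding incomparable_ideal_def ideal_gen_def
    by (intro complex_span_subset) (auto simp: R.span_zero R.span_add R.span_scale)
  moreover have "p \<in> K.span ?I" if p: "p \<in> incomparable_ideal" for p
  proof -
    have "Poly_Mapping.single m c \<in> K.span ?I" if m: "m \<in> Poly_Mapping.keys p" for m c
    proof -
      from p m obtain a b where ab: "a \<in> Poly_Mapping.keys m" "b \<in> Poly_Mapping.keys m"
        "\<not> a \<le> b" "\<not> b \<le> a" by (auto simp: incomparable_ideal_iff is_chain_def)
      then obtain n where n: "m = n + (Poly_Mapping.single a 1 + Poly_Mapping.single b 1)"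
        by (metis exponent_split order_refl)
      let ?n = "n + (Poly_Mapping.single (sup a b) 1 + Poly_Mapping.single (inf a b) 1)"
      let ?f = "Poly_Mapping.single m 1 - Poly_Mapping.single ?n 1 :: 'a poly_ring"
      \<comment> \<open>The common factor \<open>n\<close> adds the same amount to both gradings, so
        the strict inequality at \<open>a\<close>, \<open>b\<close> selects
        \<open>m\<close>.\<close>
      have less: "grading w m < grading w ?n"
        using w ab(3,4) unfolding n grading_add grading_single strict_supermodular_def by simp
      then have "?f \<noteq> 0"
        using keys_binomial[of m ?n] by (metis keys_zero insert_not_empty less_irrefl)
      moreover have "?f = Poly_Mapping.single n 1 * (indet a * indet b - indet (sup a b) * indet (inf a b))"
        by (simp add: n indet_times_indet right_diff_distrib mult_single)
      then have "?f \<in> hibi_ideal"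
        unfolding hibi_ideal_def ideal_gen_def by (auto intro: R.span_scale R.span_base)
      ultimately have "Poly_Mapping.single m 1 \<in> K.span ?I"
        using initial_form_binomial[OF less] by (intro K.span_base) (metis (mono_tags, lifting) mem_Collect_eq)
      from K.span_scale[OF this, of c] show ?thesis by (simp add: mult_single)
    qed
    then show ?thesis
      by (subst poly_mapping_sum_single[of p]) (rule K.span_sum)
  qed
  ultimately show "w \<in> initial_cone hibi_ideal incomparable_ideal"
    unfolding initial_cone_def initial_ideal_def complex_span_def by blast
qed

section \<open>Regular subdivisions of the order polytope\<close>

abbreviation lattice_hypograph :: "(real, 'a::{finite, distrib_lattice}) vec \<Rightarrow> ((real, 'a) vec \<times> real) set" where
  "lattice_hypograph w \<equiv> hypograph_hull order_polytope (psi w)"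

lemma lattice_hypograph_eq_hull:
  "lattice_hypograph w = convex hull (\<Union>a. {ideal_vertex a} \<times> {..w $ a})"
  by (simp add: hypograph_hull_def vertices_order_polytope lookup_psi)

lemma convex_lattice_hypograph: "convex (lattice_hypograph w)"
  by (simp add: hypograph_hull_def)

lemma vertex_in_lattice_hypograph:
  assumes "t \<le> w $ a"
  shows "(ideal_vertex a, t) \<in> lattice_hypograph w"
  unfolding lattice_hypograph_eq_hull using assms by (intro hull_inc) auto

text \<open>All heights \<open>w $ a\<close> are lowered by the same slack \<open>s\<close>. Since
  the weights sum to 1, the combination is lowered by exactly \<open>s\<close>, and the lowered
  points stay on their rays because \<open>s\<close> is nonnegative.\<close>

lemma lattice_hypographI:
  assumes "\<And>a. 0 \<le> u a" "sum u UNIV = 1" "x = (\<Sum>a\<in>UNIV. u a *\<^sub>R ideal_vertex a)"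
    "t \<le> (\<Sum>a\<in>UNIV. u a * w $ a)"
  shows "(x, t) \<in> lattice_hypograph w"
proof -
  define s where "s = (\<Sum>a\<in>UNIV. u a * w $ a) - t"
  have "(\<Sum>a\<in>UNIV. u a *\<^sub>R (ideal_vertex a, w $ a - s)) \<in> lattice_hypograph w"
    using assms by (intro convex_sum convex_lattice_hypograph)
      (auto intro!: vertex_in_lattice_hypograph simp: s_def)
  moreover have "(\<Sum>a\<in>UNIV. u a *\<^sub>R (ideal_vertex a, w $ a - s)) = (x, t)"
    using assms
    by (simp add: prod_eq_iff fst_sum snd_sum right_diff_distrib sum_subtractf s_def
        flip: sum_distrib_right)
  ultimately show ?thesis by simp
qed

text \<open>The points admitting such weights form a convex set containing all the rays, hence
  containing their hull.\<close>

lemma lattice_hypographE: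
  assumes "(x, t) \<in> lattice_hypograph w"
  obtains u where "\<And>a. 0 \<le> u a" "sum u UNIV = 1" "x = (\<Sum>a\<in>UNIV. u a *\<^sub>R ideal_vertex a)"
    "t \<le> (\<Sum>a\<in>UNIV. u a * w $ a)"
proof -
  let ?R = "{z. \<exists>u. (\<forall>a. 0 \<le> u a) \<and> sum u UNIV = 1 \<and> fst z = (\<Sum>a\<in>UNIV. u a *\<^sub>R ideal_vertex a) \<and>
    snd z \<le> (\<Sum>a\<in>UNIV. u a * w $ a)}"
  have "convex ?R"
  proof (rule convexI)
    fix y z and \<alpha> \<beta> :: real
    assume "y \<in> ?R" "z \<in> ?R" and ab: "0 \<le> \<alpha>" "0 \<le> \<beta>" "\<alpha> + \<beta> = 1"
    then obtain u v where u: "\<forall>a. 0 \<le> u a" "sum u UNIV = 1" "fst y = (\<Sum>a\<in>UNIV. u a *\<^sub>R ideal_vertex a)"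
        "snd y \<le> (\<Sum>a\<in>UNIV. u a * w $ a)"
      and v: "\<forall>a. 0 \<le> v a" "sum v UNIV = 1" "fst z = (\<Sum>a\<in>UNIV. v a *\<^sub>R ideal_vertex a)"
        "snd z \<le> (\<Sum>a\<in>UNIV. v a * w $ a)"
      by blast
    have "\<alpha> * snd y + \<beta> * snd z \<le> \<alpha> * (\<Sum>a\<in>UNIV. u a * w $ a) + \<beta> * (\<Sum>a\<in>UNIV. v a * w $ a)"
      using u(4) v(4) ab by (intro add_mono mult_left_mono)
    then show "\<alpha> *\<^sub>R y + \<beta> *\<^sub>R z \<in> ?R"
      using u(1-3) v(1-3) ab
      by (intro CollectI exI[of _ "\<lambda>a. \<alpha> * u a + \<beta> * v a"])
        (simp add: sum.distrib scaleR_left_distrib distrib_right scaleR_sum_right sum_distrib_left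
          mult.assoc flip: sum_distrib_left)
  qed
  moreover have "(ideal_vertex a, t) \<in> ?R" if "t \<le> w $ a" for a t
    using that by (intro CollectI exI[of _ "\<lambda>b. if b = a then 1 else 0"])
      (auto simp: if_distrib[of "\<lambda>t. t *\<^sub>R _"] if_distrib[of "\<lambda>t. t * _"] cong: if_cong)
  ultimately have "lattice_hypograph w \<subseteq> ?R"
    unfolding lattice_hypograph_eq_hull by (intro hull_minimal) auto
  with assms have "(x, t) \<in> ?R" by (rule subsetD[rotated])
  then show thesis using that by auto
qed

lemma lattice_hypograph_downward:
  assumes "(x, t) \<in> lattice_hypograph w" "s \<le> t"
  shows "(x, s) \<in> lattice_hypograph w"
  using assms(1)
proof (rule lattice_hypographE)
  fix u assume "\<And>a. 0 \<le> u a" "sum u UNIV = 1" "x = (\<Sum>a\<in>UNIV. u a *\<^sub>R ideal_vertex a)"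
    "t \<le> (\<Sum>a\<in>UNIV. u a * w $ a)"
  then show ?thesis using assms(2) by (intro lattice_hypographI[of u]) auto
qed

text \<open>A convex combination of the 0/1 points that equals \<open>ideal_vertex a\<close> has all
  its weight at \<open>a\<close>: for \<open>b\<close> different from \<open>a\<close>, a coordinate
  separating the two vertices forces the weight of \<open>b\<close> to vanish.\<close>

lemma lattice_hypograph_vertex_le:
  assumes "(ideal_vertex a, t) \<in> lattice_hypograph w"
  shows "t \<le> w $ a"
  using assms
proof (rule lattice_hypographE)
  fix u assume u: "\<And>a. 0 \<le> u a" "sum u UNIV = 1" "ideal_vertex a = (\<Sum>b\<in>UNIV. u b *\<^sub>R ideal_vertex b)"
    and t: "t \<le> (\<Sum>a\<in>UNIV. u a * w $ a)"
  have coord: "(\<Sum>b\<in>UNIV. u b * ideal_vertex b $ p) = ideal_vertex a $ p" for p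
    by (subst u(3)) simp
  have zero: "u b = 0" if "b \<noteq> a" for b
  proof (rule ccontr)
    assume "u b \<noteq> 0"
    from that have "birkhoff a \<noteq> birkhoff b"
      by (metis le_if_birkhoff_subset order.antisym order_refl)
    then obtain p where p: "(p \<in> birkhoff a) \<noteq> (p \<in> birkhoff b)" by blast
    show False
    proof (cases "p \<in> birkhoff a")
      case True
      then have "(\<Sum>b\<in>UNIV. u b * (1 - ideal_vertex b $ p)) = 0"
        using coord[of p] u(2) by (simp add: right_diff_distrib sum_subtractf ideal_vertex_nth)
      then have "u b * (1 - ideal_vertex b $ p) = 0"
        using u(1) by (subst (asm) sum_nonneg_eq_0_iff) (auto simp: ideal_vertex_nth)
      then show False using p True \<open>u b \<noteq> 0\<close> by (simp add: ideal_vertex_nth)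
    next
      case False
      then have "(\<Sum>b\<in>UNIV. u b * ideal_vertex b $ p) = 0"
        using coord[of p] by (simp add: ideal_vertex_nth)
      then have "u b * ideal_vertex b $ p = 0"
        using u(1) by (subst (asm) sum_nonneg_eq_0_iff) (auto simp: ideal_vertex_nth)
      then show False using p False \<open>u b \<noteq> 0\<close> by (simp add: ideal_vertex_nth)
    qed
  qed
  have "sum u UNIV = u a" "(\<Sum>a\<in>UNIV. u a * w $ a) = u a * w $ a"
    using zero by (auto simp: sum.remove[OF finite UNIV_I, of _ a])
  then show ?thesis using u(2) t by simp
qed

section \<open>Bounded faces of the hypograph\<close>

text \<open>If a higher point existed over \<open>x\<close>, then \<open>(x, t)\<close> would be
  interior to a vertical segment reaching arbitrarily far down, and the face property would put the
  lower end into the bounded set \<open>F\<close>.\<close>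

lemma bounded_face_lattice_hypograph_top:
  assumes F: "F face_of lattice_hypograph w" and "bounded F"
    and x: "(x, t) \<in> F" and t': "(x, t') \<in> lattice_hypograph w"
  shows "t' \<le> t"
proof (rule ccontr)
  assume "\<not> t' \<le> t"
  obtain B where B: "\<And>z. z \<in> F \<Longrightarrow> norm z \<le> B"
    using \<open>bounded F\<close> by (auto simp: bounded_iff)
  \<comment> \<open>Large enough that the second coordinate \<open>t - s\<close> has absolute value
    greater than \<open>B\<close>.\<close>
  define s where "s = \<bar>t\<bar> + \<bar>B\<bar> + 1"
  have s: "0 < s" by (simp add: s_def)
  \<comment> \<open>The parameter at which the segment from height \<open>t - s\<close> to height
    \<open>t'\<close> passes through \<open>t\<close>.\<close>
  define r where "r = s / (t' - t + s)"
  have r: "0 < r" "r < 1" using s \<open>\<not> t' \<le> t\<close> by (auto simp: r_def divide_simps)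
  have "r * (t' - t + s) = s" using s \<open>\<not> t' \<le> t\<close> by (simp add: r_def)
  then have "t = (1 - r) * (t - s) + r * t'" by (simp add: algebra_simps)
  then have "(x, t) = (1 - r) *\<^sub>R (x, t - s) + r *\<^sub>R (x, t')"
    by (simp add: prod_eq_iff scaleR_left_diff_distrib)
  moreover have "(x, t - s) \<noteq> (x, t')" using s \<open>\<not> t' \<le> t\<close> by simp
  ultimately have "(x, t) \<in> open_segment (x, t - s) (x, t')"
    using r in_segment(2) by blast
  moreover have "(x, t - s) \<in> lattice_hypograph w"
    using subsetD[OF face_of_imp_subset[OF F] x] by (rule lattice_hypograph_downward) (use s in simp)
  ultimately have "(x, t - s) \<in> F"
    using face_ofD[OF F _ _ t' x] by blast
  then have "\<bar>t - s\<bar> \<le> B" using B norm_snd_le[of "t - s" x] by fastforce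
  then show False by (simp add: s_def)
qed

lemma maximal_chain_nonempty:
  assumes "maximal_chain (C :: 'a::{finite, lattice} set)"
  shows "C \<noteq> {}"
proof -
  obtain z :: 'a where "\<forall>a. z \<le> a" using finite_ex_least by blast
  then show ?thesis using assms by (auto simp: maximal_chain_def)
qed

text \<open>\<open>F\<close> is the graph of the supporting function \<open>g\<close> over the
  simplex of \<open>C\<close>: \<open>g\<close> bounds the hypograph from above, with contact only
  over that simplex, so \<open>F\<close> is an exposed face. It is a facet because one further point
  below it completes an affine spanning set. The last conclusion, that \<open>F\<close> contains
  every highest point over the simplex, is what identifies \<open>F\<close> with other bounded
  facets.\<close>

lemma strict_supermodular_facet:
  assumes w: "strict_supermodular w" and C: "maximal_chain C"
  obtains F where "F facet_of lattice_hypograph w" "bounded F"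
    "fst ` F = convex hull (ideal_vertex ` C)"
    "\<forall>x t. x \<in> convex hull (ideal_vertex ` C) \<and> (x, t) \<in> lattice_hypograph w \<and>
      (\<forall>t'. (x, t') \<in> lattice_hypograph w \<longrightarrow> t' \<le> t) \<longrightarrow> (x, t) \<in> F"
proof -
  let ?T = "lattice_hypograph w"
  obtain g where g: "linear g" "\<And>c. c \<in> C \<Longrightarrow> g (hom_vertex c) = w $ c"
    "\<And>a. a \<notin> C \<Longrightarrow> w $ a < g (hom_vertex a)"
    using strict_supermodular_support[OF w C] by blast
  have gle: "w $ a \<le> g (hom_vertex a)" for a
    using g(2,3)[of a] by (cases "a \<in> C") auto
  have gsum: "g (\<Sum>a\<in>A. u a *\<^sub>R ideal_vertex a, 1) = (\<Sum>a\<in>A. u a * g (hom_vertex a))"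
    if "sum u A = 1" for u and A :: "'a set"
  proof -
    have "(\<Sum>a\<in>A. u a *\<^sub>R ideal_vertex a, 1) = (\<Sum>a\<in>A. u a *\<^sub>R hom_vertex a)"
      using that by (simp add: prod_eq_iff fst_sum snd_sum hom_vertex_def)
    then show ?thesis by (simp add: linear_sum[OF g(1)] linear_scale[OF g(1)])
  qed
  have below: "t \<le> g (x, 1)" and on_chain: "t = g (x, 1) \<Longrightarrow> x \<in> convex hull (ideal_vertex ` C)"
    if "(x, t) \<in> ?T" for x t
  proof -
    from that obtain u where u: "\<And>a. 0 \<le> u a" "sum u UNIV = 1"
      "x = (\<Sum>a\<in>UNIV. u a *\<^sub>R ideal_vertex a)" "t \<le> (\<Sum>a\<in>UNIV. u a * w $ a)"
      by (rule lattice_hypographE) (rule that)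
    have gx: "g (x, 1) = (\<Sum>a\<in>UNIV. u a * g (hom_vertex a))"
      unfolding u(3) by (rule gsum[OF u(2)])
    have nn: "0 \<le> u a * (g (hom_vertex a) - w $ a)" for a
      using u(1) gle by simp
    have diff: "(\<Sum>a\<in>UNIV. u a * (g (hom_vertex a) - w $ a)) = g (x, 1) - (\<Sum>a\<in>UNIV. u a * w $ a)"
      by (simp add: gx right_diff_distrib sum_subtractf)
    have "0 \<le> (\<Sum>a\<in>UNIV. u a * (g (hom_vertex a) - w $ a))"
      by (intro sum_nonneg nn)
    then show "t \<le> g (x, 1)" using diff u(4) by simp
    assume "t = g (x, 1)"
    then have "(\<Sum>a\<in>UNIV. u a * (g (hom_vertex a) - w $ a)) = 0"
      using diff u(4) \<open>0 \<le> (\<Sum>a\<in>UNIV. _ a)\<close> by simp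
    then have "u a * (g (hom_vertex a) - w $ a) = 0" for a
      using nn by (subst (asm) sum_nonneg_eq_0_iff) auto
    then have off: "u a = 0" if "a \<notin> C" for a
      using g(3)[OF that] by (metis mult_eq_0_iff less_irrefl right_minus_eq)
    have "sum u C = sum u UNIV"
      by (intro sum.mono_neutral_left) (use off in auto)
    moreover have "(\<Sum>a\<in>C. u a *\<^sub>R ideal_vertex a) = x"
      unfolding u(3) by (intro sum.mono_neutral_left) (use off in auto)
    moreover have "(\<Sum>a\<in>C. u a *\<^sub>R ideal_vertex a) \<in> convex hull (ideal_vertex ` C)"
      using u(1,2) \<open>sum u C = sum u UNIV\<close> by (intro convex_sum) (auto intro: hull_inc)
    ultimately show "x \<in> convex hull (ideal_vertex ` C)" by simp
  qed
  have graph: "(x, g (x, 1)) \<in> ?T" if x: "x \<in> convex hull (ideal_vertex ` C)" for x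
  proof -
    have "convex {x. (x, g (x, 1)) \<in> ?T}"
    proof (rule convexI)
      fix x y and \<alpha> \<beta> :: real
      assume xy: "x \<in> {x. (x, g (x, 1)) \<in> ?T}" "y \<in> {x. (x, g (x, 1)) \<in> ?T}"
        and ab: "0 \<le> \<alpha>" "0 \<le> \<beta>" "\<alpha> + \<beta> = 1"
      have "\<alpha> *\<^sub>R (x, g (x, 1)) + \<beta> *\<^sub>R (y, g (y, 1)) \<in> ?T"
        using xy ab by (intro convexD[OF convex_lattice_hypograph]) auto
      moreover have "g (\<alpha> *\<^sub>R x + \<beta> *\<^sub>R y, 1) = \<alpha> * g (x, 1) + \<beta> * g (y, 1)"
        using linear_add[OF g(1), of "\<alpha> *\<^sub>R (x, 1)" "\<beta> *\<^sub>R (y, 1)"] ab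
          linear_scale[OF g(1), of \<alpha> "(x, 1)"] linear_scale[OF g(1), of \<beta> "(y, 1)"]
        by simp
      ultimately show "\<alpha> *\<^sub>R x + \<beta> *\<^sub>R y \<in> {x. (x, g (x, 1)) \<in> ?T}" by simp
    qed
    moreover have "ideal_vertex ` C \<subseteq> {x. (x, g (x, 1)) \<in> ?T}"
      using g(2) by (auto simp: hom_vertex_def intro!: vertex_in_lattice_hypograph)
    ultimately show ?thesis using x hull_minimal[of "ideal_vertex ` C"] by blast
  qed
  define F where "F = (\<lambda>x. (x, g (x, 1))) ` (convex hull (ideal_vertex ` C))"
  have F: "F = ?T \<inter> {z. snd z = g (fst z, 1)}"
    using below on_chain graph by (fastforce simp: F_def)
  \<comment> \<open>The height minus the linear part of the affine function \<open>g (x, 1)\<close>.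
    The constant part \<open>g (0, 1)\<close> becomes the level of the supporting hyperplane, whose
    normal is \<open>adjoint h 1\<close>.\<close>
  define h where "h = (\<lambda>z :: (real, 'a) vec \<times> real. snd z - g (fst z, 0))"
  have lin_h: "linear h"
  proof (rule linearI)
    show "h (y + z) = h y + h z" for y z
      using linear_add[OF g(1), of "(fst y, 0)" "(fst z, 0)"] by (simp add: h_def)
    show "h (r *\<^sub>R z) = r *\<^sub>R h z" for r z
      using linear_scale[OF g(1), of r "(fst z, 0)"] by (simp add: h_def algebra_simps)
  qed
  have h: "adjoint h 1 \<bullet> z = snd z - g (fst z, 1) + g (0, 1)" for z
    using adjoint_works[OF lin_h, of z 1] linear_add[OF g(1), of "(fst z, 0)" "(0, 1)"]
    by (simp add: inner_commute h_def)
  have "?T \<inter> {z. adjoint h 1 \<bullet> z = g (0, 1)} face_of ?T"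
    using below by (intro face_of_Int_supporting_hyperplane_le convex_lattice_hypograph) (auto simp: h)
  then have face: "F face_of ?T" by (simp add: F h)
  obtain c0 where c0: "c0 \<in> C" using maximal_chain_nonempty[OF C] by blast
  \<comment> \<open>A point one unit below \<open>F\<close>: it shows that \<open>F\<close> is a
    proper face and supplies the vertical direction for the affine hull.\<close>
  let ?q = "(ideal_vertex c0, w $ c0 - 1)"
  have "?q \<in> ?T" by (intro vertex_in_lattice_hypograph) simp
  moreover have "?q \<notin> F"
    using g(2)[OF c0] by (auto simp: F_def hom_vertex_def)
  ultimately have lt: "aff_dim F < aff_dim ?T"
    using face_of_aff_dim_lt[OF convex_lattice_hypograph face] by blast
  let ?A = "affine hull (insert ?q F)"
  have chainF: "(ideal_vertex c, g (hom_vertex c)) \<in> F" if "c \<in> C" for c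
    unfolding F_def hom_vertex_def using that by (intro imageI hull_inc)
  \<comment> \<open>The modular relation writes the lifted vertex of \<open>a\<close> as an affine
    combination of the lifts of \<open>sup a c'\<close>, \<open>c\<close> and \<open>c'\<close>, so
    the chain generates all lifts by induction from the top.\<close>
  have vertA: "(ideal_vertex a, g (hom_vertex a)) \<in> ?A" for a
  proof (induction a rule: finite_upward_induct)
    case (1 a)
    show ?case
    proof (cases "a \<in> C")
      case True
      then show ?thesis using chainF by (intro hull_inc) blast
    next
      case False
      then obtain c c' where c: "c \<in> C" "c' \<in> C" "inf a c' = c" "\<not> a \<le> c'" "\<not> c' \<le> a"
        using maximal_chain_step[OF C] by blast
      let ?s = "sup a c'" and ?p = "\<lambda>a. (ideal_vertex a, g (hom_vertex a))"
      have "?p ?s \<in> ?A"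
        using c(5) by (intro 1) (metis less_le sup.cobounded1 sup.cobounded2)
      then have "?p ?s + 1 *\<^sub>R (?p c - ?p c') \<in> ?A"
        using c(1,2) chainF by (intro mem_affine_3_minus) (auto intro: hull_inc)
      moreover have "ideal_vertex ?s + (ideal_vertex c - ideal_vertex c') = ideal_vertex a"
        using ideal_vertex_modular[of a c'] c(3) by (simp add: algebra_simps)
      moreover have "g (hom_vertex ?s) + g (hom_vertex c) = g (hom_vertex a) + g (hom_vertex c')"
        using hom_vertex_modular[of a c'] c(3) by (metis g(1) linear_add)
      then have "g (hom_vertex ?s) + (g (hom_vertex c) - g (hom_vertex c')) = g (hom_vertex a)"
        by simp
      ultimately show ?thesis by (simp only: scaleR_one diff_Pair add_Pair)
    qed
  qed
  have "(ideal_vertex a, s) \<in> ?A" for a s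
  proof -
    \<comment> \<open>The difference of the two points over \<open>c0\<close> is the vertical vector
      of length 1 pointing down.\<close>
    have "(ideal_vertex a, g (hom_vertex a)) + (g (hom_vertex a) - s) *\<^sub>R (?q - (ideal_vertex c0, w $ c0)) \<in> ?A"
      using vertA chainF[OF c0] g(2)[OF c0] by (intro mem_affine_3_minus) (auto intro: hull_inc)
    then show ?thesis by simp
  qed
  then have "?T \<subseteq> ?A"
    unfolding lattice_hypograph_eq_hull
    by (intro hull_minimal) (auto intro: affine_imp_convex)
  then have "aff_dim ?T \<le> aff_dim (insert ?q F)"
    by (metis aff_dim_affine_hull aff_dim_subset)
  also have "\<dots> \<le> aff_dim F + 1" by (simp add: aff_dim_insert)
  finally have "F facet_of ?T"
    using face lt chainF[OF c0] by (auto simp: facet_of_def)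
  moreover have "bounded F"
  proof -
    have "linear (\<lambda>x. g (x, 0))"
      using linear_compose[of "\<lambda>x. (x, 0)" g] g(1) by (auto simp: o_def linear_iff)
    then have "continuous_on S (\<lambda>x. g (x, 0))" for S
      by (simp add: linear_continuous_on linear_conv_bounded_linear)
    then have "continuous_on S (\<lambda>x. (x, g (x, 0) + g (0, 1)))" for S
      by (intro continuous_on_Pair continuous_on_add continuous_on_const continuous_on_id)
    moreover have "g (x, 0) + g (0, 1) = g (x, 1)" for x
      using linear_add[OF g(1), of "(x, 0)" "(0, 1)"] by simp
    ultimately have "continuous_on S (\<lambda>x. (x, g (x, 1)))" for S
      by (simp only:)
    then show ?thesis
      unfolding F_def
      by (intro compact_imp_bounded compact_continuous_image finite_imp_compact_convex_hull) auto
  qed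
  moreover have "fst ` F = convex hull (ideal_vertex ` C)"
    by (simp add: F_def image_image)
  moreover have "(x, t) \<in> F" if "x \<in> convex hull (ideal_vertex ` C)" "(x, t) \<in> ?T"
    "\<forall>t'. (x, t') \<in> ?T \<longrightarrow> t' \<le> t" for x t
  proof -
    have "t = g (x, 1)"
      using below[OF that(2)] that(3) graph[OF that(1)] by (simp add: order.antisym)
    then show ?thesis using that(1) by (simp add: F_def)
  qed
  ultimately show thesis using that by blast
qed

lemma fst_lattice_hypograph:
  assumes "(x, t) \<in> lattice_hypograph w"
  shows "x \<in> order_polytope"
  using assms
proof (rule lattice_hypographE)
  fix u assume "\<And>a. 0 \<le> u a" "sum u UNIV = 1" "x = (\<Sum>b\<in>UNIV. u b *\<^sub>R ideal_vertex b)"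
  then show ?thesis
    by (auto intro!: convex_sum convex_order_polytope ideal_vertex_in_order_polytope)
qed

text \<open>Chain simplices are cells by the facet construction. Conversely, a relative interior
  point of a bounded facet \<open>G\<close> is a highest point over some chain simplex, hence lies
  in the facet \<open>F\<close> of that chain; then \<open>G\<close> is contained in
  \<open>F\<close>, and equal dimension gives \<open>G = F\<close>.\<close>

lemma regular_subdivision_strict_supermodular:
  assumes w: "strict_supermodular w"
  shows "regular_subdivision order_polytope (psi w) =
    {convex hull (ideal_vertex ` C) | C. maximal_chain C}"
proof (intro equalityI subsetI)
  fix Q assume "Q \<in> {convex hull (ideal_vertex ` C) | C :: 'a set. maximal_chain C}"
  then obtain C :: "'a set" where C: "maximal_chain C" "Q = convex hull (ideal_vertex ` C)" by blast
  obtain F where "F facet_of lattice_hypograph w" "bounded F" "fst ` F = convex hull (ideal_vertex ` C)"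
    by (rule strict_supermodular_facet[OF w C(1)]) (rule that)
  then show "Q \<in> regular_subdivision order_polytope (psi w)"
    unfolding regular_subdivision_def C(2) by blast
next
  fix Q assume "Q \<in> regular_subdivision order_polytope (psi w)"
  then obtain G where G: "G facet_of lattice_hypograph w" "bounded G" "Q = fst ` G"
    unfolding regular_subdivision_def by blast
  then have Gface: "G face_of lattice_hypograph w" and "G \<noteq> {}" and "convex G"
    by (auto simp: facet_of_def face_of_def)
  then have "rel_interior G \<noteq> {}" by (simp add: rel_interior_eq_empty)
  then obtain x t where xt: "(x, t) \<in> rel_interior G" by auto
  then have xtG: "(x, t) \<in> G" using rel_interior_subset by blast
  then have xtT: "(x, t) \<in> lattice_hypograph w" using Gface by (auto simp: face_of_def)
  obtain C :: "'a set" where C: "maximal_chain C" "x \<in> convex hull (ideal_vertex ` C)"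
    using order_polytope_chain_cover[OF fst_lattice_hypograph[OF xtT]] by blast
  obtain F where F: "F facet_of lattice_hypograph w" "fst ` F = convex hull (ideal_vertex ` C)"
    and topF: "\<forall>x t. x \<in> convex hull (ideal_vertex ` C) \<and> (x, t) \<in> lattice_hypograph w \<and>
      (\<forall>t'. (x, t') \<in> lattice_hypograph w \<longrightarrow> t' \<le> t) \<longrightarrow> (x, t) \<in> F"
    by (rule strict_supermodular_facet[OF w C(1)]) (rule that)
  have "(x, t) \<in> F"
    using topF C(2) xtT bounded_face_lattice_hypograph_top[OF Gface G(2) xtG] by simp
  then have meet: "F \<inter> rel_interior G \<noteq> {}" using xt by blast
  have Fface: "F face_of lattice_hypograph w" using F(1) by (simp add: facet_of_def)
  have "G \<subseteq> F"
    by (rule subset_of_face_of[OF Fface face_of_imp_subset[OF Gface] meet])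
  then have "G face_of F"
    using face_of_imp_subset[OF Fface] by (rule face_of_subset[OF Gface])
  moreover have "aff_dim G = aff_dim F" using G(1) F(1) by (simp add: facet_of_def)
  moreover have "convex F" using Fface by (rule face_of_imp_convex)
  ultimately have "G = F" using face_of_aff_dim_lt by (metis less_irrefl)
  then show "Q \<in> {convex hull (ideal_vertex ` C) | C. maximal_chain C}"
    using G(3) F(2) C(1) by blast
qed

text \<open>Consider the cell of a maximal chain through \<open>inf a b\<close> and
  \<open>sup a b\<close>. The midpoint of these two vertices is also the midpoint of the vertices of
  \<open>a\<close> and \<open>b\<close>; if strictness fails there, the segment over
  \<open>a\<close> and \<open>b\<close> reaches the facet above the cell, and the face property
  pulls both \<open>a\<close> and \<open>b\<close> into the chain.\<close>

lemma strict_supermodular_if_chain_subdivision: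
  fixes w :: "(real, 'a::{finite, distrib_lattice}) vec"
  assumes sub: "regular_subdivision order_polytope (psi w) =
    {convex hull (ideal_vertex ` C) | C. maximal_chain C}"
  shows "strict_supermodular w"
  unfolding strict_supermodular_def
proof (intro allI impI, rule ccontr)
  fix a b :: 'a
  assume inc: "\<not> a \<le> b \<and> \<not> b \<le> a" and ge: "\<not> w $ a + w $ b < w $ (sup a b) + w $ (inf a b)"
  let ?s = "sup a b" and ?i = "inf a b" and ?T = "lattice_hypograph w"
  have "is_chain {?i, ?s}" by (auto simp: is_chain_def intro: le_infI1 le_supI1)
  then obtain C where C: "maximal_chain C" "?i \<in> C" "?s \<in> C"
    using is_chain_extend by (metis insert_subset)
  then have "convex hull (ideal_vertex ` C) \<in> regular_subdivision order_polytope (psi w)"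
    unfolding sub by blast
  then obtain F where F: "F face_of ?T" "bounded F" "fst ` F = convex hull (ideal_vertex ` C)"
    unfolding regular_subdivision_def by (auto simp: facet_of_def)
  have "ideal_vertex ?i \<in> fst ` F" "ideal_vertex ?s \<in> fst ` F"
    unfolding F(3) using C by (auto intro: hull_inc)
  then obtain ti ts where t: "(ideal_vertex ?i, ti) \<in> F" "(ideal_vertex ?s, ts) \<in> F" by force
  have "F \<subseteq> ?T" "convex F" using F(1) by (auto simp: face_of_def)
  then have le: "ti \<le> w $ ?i" "ts \<le> w $ ?s"
    using t lattice_hypograph_vertex_le by blast+
  let ?x = "(1/2) *\<^sub>R ideal_vertex a + (1/2) *\<^sub>R ideal_vertex b :: (real, 'a) vec"
  let ?y = "w $ a / 2 + w $ b / 2"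
  have "(1/2) *\<^sub>R (ideal_vertex ?s, ts) + (1/2) *\<^sub>R (ideal_vertex ?i, ti) \<in> F"
    using t by (intro convexD[OF \<open>convex F\<close>]) auto
  then have xF: "(?x, ts / 2 + ti / 2) \<in> F"
    using ideal_vertex_modular[of a b] by (simp flip: scaleR_right_distrib)
  have "(1/2) *\<^sub>R (ideal_vertex a, w $ a) + (1/2) *\<^sub>R (ideal_vertex b, w $ b) \<in> ?T"
    by (intro convexD[OF convex_lattice_hypograph] vertex_in_lattice_hypograph) auto
  then have "(?x, ?y) \<in> ?T" by simp
  then have "?y \<le> ts / 2 + ti / 2"
    by (rule bounded_face_lattice_hypograph_top[OF F(1,2) xF])
  \<comment> \<open>The facet point is highest over \<open>?x\<close>, which bounds
    \<open>?y\<close> from above; \<open>le\<close> and the assumed failure \<open>ge\<close> give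
    the reverse inequality.\<close>
  then have "?y = ts / 2 + ti / 2" using ge le by simp
  then have xyF: "(?x, ?y) \<in> F" using xF by simp
  have "ideal_vertex a \<noteq> (ideal_vertex b :: (real, 'a) vec)"
    using inc inj_ideal_vertex by (metis injD order_refl)
  then have "(?x, ?y) \<in> open_segment (ideal_vertex a, w $ a) (ideal_vertex b, w $ b)"
    unfolding in_segment(2) by (intro conjI exI[of _ "1/2"]) auto
  then have "(ideal_vertex a, w $ a) \<in> F" "(ideal_vertex b, w $ b) \<in> F"
    using F(1) xyF vertex_in_lattice_hypograph[of "w $ a" w a] vertex_in_lattice_hypograph[of "w $ b" w b]
    unfolding face_of_def by blast+
  then have hull: "ideal_vertex a \<in> convex hull (ideal_vertex ` C)" "ideal_vertex b \<in> convex hull (ideal_vertex ` C)"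
    unfolding F(3)[symmetric] by force+
  \<comment> \<open>A vertex of the polytope lying in a smaller hull is extreme there as well, hence
    one of the points generating that hull.\<close>
  have "d \<in> C" if d: "ideal_vertex d \<in> convex hull (ideal_vertex ` C)" for d
  proof -
    have "convex hull (ideal_vertex ` C) \<subseteq> order_polytope"
      unfolding order_polytope_eq by (intro hull_mono) auto
    moreover have "ideal_vertex d extreme_point_of order_polytope"
      using vertices_order_polytope by (auto simp: vertices_def)
    ultimately have "ideal_vertex d extreme_point_of convex hull (ideal_vertex ` C)"
      using d by (auto simp: extreme_point_of_def)
    then show ?thesis
      using extreme_point_of_convex_hull inj_ideal_vertex by (auto dest: injD)
  qed
  then have "a \<in> C" "b \<in> C" using hull by blast+
  then show False using C(1) inc by (auto simp: maximal_chain_def is_chain_def)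
qed

section \<open>The cone of strictly supermodular functions\<close>

lemma open_strict_supermodular: "open (Collect strict_supermodular)"
proof -
  let ?J = "{(a, b). \<not> a \<le> b \<and> \<not> b \<le> (a :: 'a)}"
  have "open (\<Inter>ab\<in>?J. {w :: (real, 'a) vec.
      w $ fst ab + w $ snd ab < w $ (sup (fst ab) (snd ab)) + w $ (inf (fst ab) (snd ab))})"
    by (intro open_INT open_Collect_less ballI continuous_intros finite)
  also have "\<dots> = Collect strict_supermodular"
    by (auto simp: strict_supermodular_def)
  finally show ?thesis .
qed

text \<open>The rank \<open>card (birkhoff a)\<close> is modular, so squaring leaves the excess
  \<open>2 * ((x - i) * (y - i))\<close>, where \<open>x\<close>, \<open>y\<close>, \<open>i\<close>
  are the ranks of \<open>a\<close>, \<open>b\<close> and their meet; both factors are positive for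
  incomparable elements. This is the witness that the cone is nonempty.\<close>

lemma strict_supermodular_card_square:
  "strict_supermodular (\<chi> a. (real (card (birkhoff a)))\<^sup>2)"
  unfolding strict_supermodular_def
proof (intro allI impI)
  fix a b :: 'a assume inc: "\<not> a \<le> b \<and> \<not> b \<le> a"
  let ?c = "\<lambda>a. real (card (birkhoff a))"
  have "inf a b \<noteq> a" "inf a b \<noteq> b"
    using inc by (metis inf.cobounded2, metis inf.cobounded1)
  then have "inf a b < a" "inf a b < b"
    by (simp_all add: less_le)
  then have "?c (inf a b) < ?c a" "?c (inf a b) < ?c b"
    by (simp_all add: birkhoff_strict_mono psubset_card_mono)
  then have "0 < (?c a - ?c (inf a b)) * (?c b - ?c (inf a b))" by simp
  moreover have "?c (sup a b) = ?c a + ?c b - ?c (inf a b)"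
    using card_Un_Int[of "birkhoff a" "birkhoff b"] by (simp add: birkhoff_sup birkhoff_inf)
  moreover have "(x + y - i)\<^sup>2 + i\<^sup>2 = x\<^sup>2 + y\<^sup>2 + 2 * ((x - i) * (y - i))" for x y i :: real
    by (simp add: power2_eq_square algebra_simps)
  ultimately show "(\<chi> a. (?c a)\<^sup>2) $ a + (\<chi> a. (?c a)\<^sup>2) $ b
      < (\<chi> a. (?c a)\<^sup>2) $ (sup a b) + (\<chi> a. (?c a)\<^sup>2) $ (inf a b)"
    by simp
qed

text \<open>A nonempty open set spans the whole space.\<close>

lemma dim_strict_supermodular:
  "dim (Collect strict_supermodular :: (real, 'a::{finite, distrib_lattice}) vec set) = CARD('a)"
proof -
  let ?D = "Collect strict_supermodular :: (real, 'a) vec set"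
  have "interior ?D \<noteq> {}"
    unfolding interior_open[OF open_strict_supermodular]
    using strict_supermodular_card_square by blast
  then have "\<not> dim ?D < DIM((real, 'a) vec)"
    using empty_interior_lowdim by blast
  moreover have "dim ?D \<le> DIM((real, 'a) vec)" by (rule dim_subset_UNIV)
  ultimately show ?thesis by simp
qed

lemma lookup_scaleR: "Poly_Mapping.lookup (r *\<^sub>R c) k = r *\<^sub>R Poly_Mapping.lookup c k"
  by (simp add: scaleR_poly_mapping_def)

lemma linear_psi: "linear psi"
proof (rule linearI)
  show "psi (v + w) = psi v + psi w" for v w :: "(real, 'a) vec"
    by (simp add: psi_def single_add sum.distrib)
  show "psi (r *\<^sub>R w) = r *\<^sub>R psi w" for r and w :: "(real, 'a) vec"
    by (rule poly_mapping_eqI)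
      (simp add: psi_def lookup_sum lookup_single lookup_scaleR when_def sum_distrib_left if_distrib
        cong: if_cong)
qed

lemma inj_psi: "inj psi"
  by (rule injI) (metis lookup_psi vec_eq_iff)

lemma coord_space_order_polytope: "coord_space (vertices order_polytope) = range psi"
proof (intro equalityI subsetI)
  fix c :: "(real, 'a) vec \<Rightarrow>\<^sub>0 real" assume "c \<in> coord_space (vertices order_polytope)"
  then have c: "Poly_Mapping.keys c \<subseteq> range ideal_vertex"
    by (simp add: coord_space_def vertices_order_polytope)
  have "c = psi (\<chi> a. Poly_Mapping.lookup c (ideal_vertex a))"
  proof (rule poly_mapping_eqI)
    fix k
    show "Poly_Mapping.lookup c k
        = Poly_Mapping.lookup (psi (\<chi> a. Poly_Mapping.lookup c (ideal_vertex a))) k"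
    proof (cases "k \<in> range ideal_vertex")
      case True
      then show ?thesis by (auto simp: lookup_psi)
    next
      case False
      then have "Poly_Mapping.lookup c k = 0" using c by (auto simp: in_keys_iff)
      then show ?thesis using False by (auto simp: psi_def lookup_sum lookup_single when_def intro!: sum.neutral)
    qed
  qed
  then show "c \<in> range psi" by blast
next
  fix c :: "(real, 'a) vec \<Rightarrow>\<^sub>0 real" assume "c \<in> range psi"
  then obtain w where "c = psi w" by blast
  then have "Poly_Mapping.lookup c k = 0" if "k \<notin> range ideal_vertex" for k
    using that by (auto simp: psi_def lookup_sum lookup_single when_def intro!: sum.neutral)
  then show "c \<in> coord_space (vertices order_polytope)"
    unfolding coord_space_def vertices_order_polytope by (auto simp: in_keys_iff)
qed

theorem corollary2p12:
  shows "maximal_secondary_cone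
    (order_polytope :: (real ^ 'a::{finite, distrib_lattice}) set)
    (psi ` initial_cone hibi_ideal incomparable_ideal)"
proof -
  let ?Q = "order_polytope :: (real, 'a) vec set"
  let ?D = "Collect strict_supermodular :: (real, 'a) vec set"
  obtain w0 where w0: "w0 \<in> ?D" using strict_supermodular_card_square by blast
  \<comment> \<open>All strictly supermodular functions induce the chain subdivision, and only they
    do, so the cone is the one belonging to any single \<open>w0\<close> among them.\<close>
  have "psi ` ?D = secondary_cone ?Q (regular_subdivision ?Q (psi w0))"
  proof (intro equalityI subsetI)
    fix c assume "c \<in> psi ` ?D"
    then show "c \<in> secondary_cone ?Q (regular_subdivision ?Q (psi w0))"
      using w0 by (auto simp: secondary_cone_def coord_space_order_polytope
          regular_subdivision_strict_supermodular)
  next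
    fix c assume "c \<in> secondary_cone ?Q (regular_subdivision ?Q (psi w0))"
    then obtain w where "c = psi w" "regular_subdivision ?Q (psi w) = regular_subdivision ?Q (psi w0)"
      by (auto simp: secondary_cone_def coord_space_order_polytope)
    then show "c \<in> psi ` ?D"
      using w0 strict_supermodular_if_chain_subdivision[of w]
      by (auto simp: regular_subdivision_strict_supermodular)
  qed
  then have "psi ` ?D \<in> secondary_fan ?Q"
    unfolding secondary_fan_def coord_space_order_polytope by blast
  \<comment> \<open>An injective linear map preserves dimension, so full dimension in the function
    space becomes the number of vertices.\<close>
  moreover have "dim (psi ` ?D) = dim ?D"
    by (intro eucl.dim_image_eq linear_psi inj_on_subset[OF inj_psi]) simp
  moreover have "card (vertices ?Q) = CARD('a)"
    unfolding vertices_order_polytope by (rule card_image[OF inj_ideal_vertex])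
  ultimately show ?thesis
    unfolding maximal_secondary_cone_def initial_cone_hibi_incomparable
    by (simp add: dim_strict_supermodular)
qed

end
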